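(* Let $\mathcal{G}$ be the standard Borel space of countable groups, i.e. of group structures with domain $\omega$. For $A,B\in\mathcal{G}$ write $A \twoheadleftarrow B$ if there is a surjective group homomorphism from $B$ onto $A$. Then the relation $\{(A,B)\in\mathcal G^2 : A \twoheadleftarrow B\}$ is a complete analytic quasi-order. Consequently, the bi-epimorphism relation on $\mathcal G$ ($A$ and $B$ are related iff $A\twoheadleftarrow B$ and $B\twoheadleftarrow A$) is a complete analytic equivalence relation.
   Context: A group with domain $\omega$ is coded by its multiplication table, i.e. by an element of $2^{\omega\times\omega\times\omega}$; the set of codes of groups is a Borel subset, giving the standard Borel space $\mathcal G$. A quasi-order $Q$ on a standard Borel space $Y$ is a complete analytic quasi-order if $Q$ is analytic and for every analytic quasi-order $P$ on a standard Borel space $X$ there is a Borel map $f\colon X\to Y$ with $x\,P\,x' \iff f(x)\,Q\,f(x')$ for all $x,x'\in X$. A complete analytic equivalence relation is defined analogously, with analytic equivalence relations in place of analytic quasi-orders. *)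

theory Defs
  imports "HOL-Analysis.Analysis" "HOL-Probability.Probability" "HOL-Algebra.Group"
begin

definition analytic :: "'a::topological_space set \<Rightarrow> bool" where
  "analytic S \<longleftrightarrow> S = {} \<or>
     (\<exists>f :: (nat \<Rightarrow> nat) \<Rightarrow> 'a. continuous_on UNIV f \<and> f ` UNIV = S)"

definition borel_map :: "'a::topological_space set \<Rightarrow> 'b::topological_space set \<Rightarrow> ('a \<Rightarrow> 'b) \<Rightarrow> bool" where
  "borel_map X Y f \<longleftrightarrow> f \<in> measurable (restrict_space borel X) (restrict_space borel Y)"

definition quasi_order_on :: "'a set \<Rightarrow> ('a \<times> 'a) set \<Rightarrow> bool" where
  "quasi_order_on X Q \<longleftrightarrow> Q \<subseteq> X \<times> X \<and> refl_on X Q \<and> trans Q"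

definition equiv_rel_on :: "'a set \<Rightarrow> ('a \<times> 'a) set \<Rightarrow> bool" where
  "equiv_rel_on X E \<longleftrightarrow> equiv X E"

definition borel_reduces :: "'a::topological_space set \<Rightarrow> ('a \<times> 'a) set \<Rightarrow>
    'b::topological_space set \<Rightarrow> ('b \<times> 'b) set \<Rightarrow> bool" where
  "borel_reduces X P Y Q \<longleftrightarrow> (\<exists>f. borel_map X Y f \<and> f ` X \<subseteq> Y \<and>
      (\<forall>x\<in>X. \<forall>x'\<in>X. (x, x') \<in> P \<longleftrightarrow> (f x, f x') \<in> Q))"

text \<open>Codes of groups with domain omega: c (a,b,d) iff a * b = d.\<close>
type_synonym code = "nat \<times> nat \<times> nat \<Rightarrow> bool"

definition code_mult :: "code \<Rightarrow> nat \<Rightarrow> nat \<Rightarrow> nat" where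
  "code_mult c a b = (THE d. c (a, b, d))"

definition code_grp :: "code \<Rightarrow> nat monoid" where
  "code_grp c = \<lparr>carrier = UNIV, mult = code_mult c,
     one = (THE e. \<forall>x. code_mult c e x = x \<and> code_mult c x e = x)\<rparr>"

definition group_codes :: "code set" where
  "group_codes = {c. (\<forall>a b. \<exists>!d. c (a, b, d)) \<and> group (code_grp c)}"

definition epi_rel :: "(code \<times> code) set" where
  "epi_rel = {(A, B). A \<in> group_codes \<and> B \<in> group_codes \<and>
     (\<exists>h. h \<in> hom (code_grp B) (code_grp A) \<and> h ` carrier (code_grp B) = carrier (code_grp A))}"

definition biepi_rel :: "(code \<times> code) set" where
  "biepi_rel = {(A, B). (A, B) \<in> epi_rel \<and> (B, A) \<in> epi_rel}"

end

theory Submission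
  imports Defs "HOL-Library.Poly_Mapping"
begin

text \<open>
  The reduction assigns to a point a torsion-free abelian group. Write the analytic quasi-order as
  the projection of a closed relation \<open>C z \<gamma> w\<close> between codes, \<open>\<gamma>\<close> being the witness. For a code \<open>z\<close>
  consider the tree of finite approximations to chains \<open>C z \<gamma>\<^sub>0 w\<^sub>1\<close>, \<open>C w\<^sub>1 \<gamma>\<^sub>1 w\<^sub>2\<close>, \<open>\<dots>\<close>, each node being
  labelled by the approximation of the last point of the chain. An infinite branch with labels
  converging to \<open>y\<close> is a chain from \<open>z\<close> to \<open>y\<close>, so by transitivity such a branch exists iff the
  points are related; and a witness from \<open>x\<close> to \<open>y\<close> maps the tree of \<open>y\<close> into that of \<open>x\<close> by
  prefixing (as in the Yoneda lemma, the empty chain at \<open>y\<close> records the map).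

  The tree is turned into a subgroup of a rational vector space with the nodes as basis vectors by
  making each node, and each difference of a node and its parent, infinitely divisible by a prime
  that depends on the label. A homomorphism respects these divisible subgroups; hence it sends a node
  to a combination of nodes with the same label, and the coefficient at a node is the sum of the
  coefficients at its children. So as soon as the root has a nonzero coefficient, the images of the
  empty chains lead to a branch. A free supply of divisible lines makes homomorphisms onto, except
  for one element \<open>(Root - Aux) / p\<close>, which no divisible element can hit; this is
  what forces a surjective homomorphism not to vanish on the root.
\<close>

alias lookup = Poly_Mapping.lookup
alias additive = Modules.additive
alias keys = Poly_Mapping.keys
alias single = Poly_Mapping.single

section \<open>The relations are analytic\<close>

definition graph_code :: "(nat \<Rightarrow> nat \<Rightarrow> nat) \<Rightarrow> code" where
  "graph_code m = (\<lambda>(a, b, d). m a b = d)"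

text \<open>The unit and the inverse are explicit data and all laws are equations, so that the
  condition is closed in the triple. Left unit and left inverse already force a group.\<close>

definition group_law :: "(nat \<Rightarrow> nat \<Rightarrow> nat) \<Rightarrow> nat \<Rightarrow> (nat \<Rightarrow> nat) \<Rightarrow> bool" where
  "group_law m e i \<longleftrightarrow>
     (\<forall>a b c. m (m a b) c = m a (m b c)) \<and> (\<forall>a. m e a = a) \<and> (\<forall>a. m (i a) a = e)"

lemma code_mult_graph_code [simp]: "code_mult (graph_code m) = m"
  by (intro ext) (simp add: code_mult_def graph_code_def)

lemma carrier_code_grp [simp]: "carrier (code_grp c) = UNIV"
  and mult_code_grp [simp]: "mult (code_grp c) = code_mult c"
  by (simp_all add: code_grp_def)

lemma group_code_grp:
  assumes "group_law (code_mult c) e i"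
  shows "group (code_grp c)"
proof -
  let ?m = "code_mult c"
  have m: "\<And>a b d. ?m (?m a b) d = ?m a (?m b d)" "\<And>a. ?m e a = a" "\<And>a. ?m (i a) a = e"
    using assms by (auto simp: group_law_def)
  let ?G = "\<lparr>carrier = UNIV, mult = ?m, one = e\<rparr>"
  have G: "group ?G"
  proof (rule groupI, simp_all add: m)
    show "\<exists>y. ?m y x = e" for x using m(3) by blast
  qed
  interpret G: group ?G by (rule G)
  have r: "?m a e = a" for a
    using G.r_one[of a] by simp
  \<comment> \<open>The unit of \<open>code_grp\<close> is a definite description; it has to be
    identified with \<open>e\<close> before the two structures agree.\<close>
  have "(THE e. \<forall>x. ?m e x = x \<and> ?m x e = x) = e"
  proof (rule the_equality)
    show "\<forall>x. ?m e x = x \<and> ?m x e = x" by (simp add: m r)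
    fix u assume "\<forall>x. ?m u x = x \<and> ?m x u = x"
    then show "u = e" by (metis m(2))
  qed
  then have "code_grp c = ?G" by (simp add: code_grp_def)
  with G show ?thesis by simp
qed

lemma graph_code_in_group_codes:
  assumes "group_law m e i" shows "graph_code m \<in> group_codes"
proof -
  have "group (code_grp (graph_code m))"
    by (rule group_code_grp[of _ e i]) (simp add: assms)
  moreover have "\<exists>!d. graph_code m (a, b, d)" for a b
    by (auto simp: graph_code_def)
  ultimately show ?thesis by (simp add: group_codes_def)
qed

lemma group_codesE:
  assumes "c \<in> group_codes"
  obtains e i where "c = graph_code (code_mult c)" "group_law (code_mult c) e i"
proof -
  have ex: "\<And>a b. \<exists>!d. c (a, b, d)" and "group (code_grp c)"
    using assms by (auto simp: group_codes_def)
  then interpret G: group "code_grp c" by simp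
  have eq: "c (a, b, d) \<longleftrightarrow> code_mult c a b = d" for a b d
  proof
    show "code_mult c a b = d" if "c (a, b, d)"
      unfolding code_mult_def by (rule the1_equality[OF ex that])
    show "c (a, b, d)" if "code_mult c a b = d"
      using theI'[OF ex[of a b]] that by (simp add: code_mult_def)
  qed
  have "c = graph_code (code_mult c)"
    by (auto simp: graph_code_def fun_eq_iff eq)
  moreover have "group_law (code_mult c) \<one>\<^bsub>code_grp c\<^esub> (\<lambda>a. inv\<^bsub>code_grp c\<^esub> a)"
    using G.m_assoc G.l_one G.l_inv unfolding group_law_def carrier_code_grp mult_code_grp by blast
  ultimately show ?thesis by (rule that)
qed

lemma epi_rel_iff:
  "(A, B) \<in> epi_rel \<longleftrightarrow> A \<in> group_codes \<and> B \<in> group_codes \<and>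
     (\<exists>h. (\<forall>a b. h (code_mult B a b) = code_mult A (h a) (h b)) \<and> surj h)"
  by (auto simp: epi_rel_def hom_def)

lemma quasi_order_on_epi_rel: "quasi_order_on group_codes epi_rel"
  unfolding quasi_order_on_def
proof (intro conjI)
  show "epi_rel \<subseteq> group_codes \<times> group_codes"
    by (auto simp: epi_rel_def)
  have "(c, c) \<in> epi_rel" if "c \<in> group_codes" for c
    unfolding epi_rel_iff using that by (auto intro!: exI[of _ "\<lambda>x. x"])
  then show "refl_on group_codes epi_rel"
    by (auto simp: refl_on_def)
  show "trans epi_rel"
  proof (rule transI)
    fix A B C assume "(A, B) \<in> epi_rel" "(B, C) \<in> epi_rel"
    then obtain h k where "A \<in> group_codes" "C \<in> group_codes"
      and h: "\<And>a b. h (code_mult B a b) = code_mult A (h a) (h b)" "surj h"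
      and k: "\<And>a b. k (code_mult C a b) = code_mult B (k a) (k b)" "surj k"
      by (auto simp: epi_rel_iff)
    then show "(A, C) \<in> epi_rel"
      unfolding epi_rel_iff
      by (intro conjI exI[of _ "h \<circ> k"]) (simp_all add: comp_surj del: comp_apply, simp)
  qed
qed

lemma biepi_rel_eq: "biepi_rel = epi_rel \<inter> prod.swap ` epi_rel"
proof -
  have "(a, b) \<in> prod.swap ` epi_rel \<longleftrightarrow> (b, a) \<in> epi_rel" for a b
    using image_iff[of "(a, b)" prod.swap epi_rel] by (auto intro: rev_bexI[of "(b, a)"])
  then show ?thesis by (auto simp: biepi_rel_def)
qed

lemma equiv_rel_on_biepi_rel: "equiv_rel_on group_codes biepi_rel"
proof -
  have "trans biepi_rel"
    using quasi_order_on_epi_rel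
    by (auto simp: biepi_rel_def quasi_order_on_def trans_def)
  then show ?thesis
    using quasi_order_on_epi_rel
    by (auto simp: equiv_rel_on_def equiv_def biepi_rel_def quasi_order_on_def refl_on_def sym_def)
qed

section \<open>Continuity into discrete spaces, prefixes and cylinders\<close>

lemma continuous_on_discreteI:
  fixes f :: "'a::topological_space \<Rightarrow> 'b::discrete_topology"
  assumes "\<And>y. open {x. f x = y}"
  shows "continuous_on UNIV f"
proof -
  have "open (f -` B)" for B
  proof -
    have "f -` B = (\<Union>y\<in>B. {x. f x = y})" by auto
    then show ?thesis using assms by auto
  qed
  then show ?thesis by (simp add: continuous_on_open_vimage)
qed

lemma open_fibre:
  fixes f :: "'a::topological_space \<Rightarrow> 'b::discrete_topology"
  assumes "continuous_on UNIV f"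
  shows "open {x. f x = y}"
proof -
  have "{x. f x = y} = f -` {y}" by auto
  then show ?thesis
    using assms Topological_Spaces.open_discrete[of "{y}"] by (simp add: continuous_on_open_vimage)
qed

lemma continuous_on_discrete2:
  fixes f :: "'a::topological_space \<Rightarrow> 'b::discrete_topology" and g :: "'a \<Rightarrow> 'c::discrete_topology"
    and H :: "'b \<Rightarrow> 'c \<Rightarrow> 'd::discrete_topology"
  assumes "continuous_on UNIV f" "continuous_on UNIV g"
  shows "continuous_on UNIV (\<lambda>x. H (f x) (g x))"
proof (rule continuous_on_discreteI)
  fix y
  have "{x. H (f x) (g x) = y} = (\<Union>(u, v)\<in>{(u, v). H u v = y}. {x. f x = u} \<inter> {x. g x = v})"
    by auto
  moreover have "open \<dots>"
    using assms by (intro open_UN) (auto intro!: open_Int open_fibre)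
  ultimately show "open {x. H (f x) (g x) = y}" by simp
qed

lemma continuous_on_apply:
  fixes g :: "('a \<Rightarrow> 'b::discrete_topology) \<Rightarrow> 'a::discrete_topology"
  assumes "continuous_on UNIV g"
  shows "continuous_on UNIV (\<lambda>\<alpha>. \<alpha> (g \<alpha>))"
proof (rule continuous_on_discreteI)
  fix y
  have "{\<alpha>. \<alpha> (g \<alpha>) = y} = (\<Union>k. {\<alpha>. g \<alpha> = k} \<inter> {\<alpha>. \<alpha> k = y})"
    by auto
  moreover have "open \<dots>"
    using assms by (intro open_UN) (auto intro!: open_Int open_fibre)
  ultimately show "open {\<alpha>. \<alpha> (g \<alpha>) = y}" by simp
qed

definition pre :: "nat \<Rightarrow> (nat \<Rightarrow> 'a) \<Rightarrow> 'a list" where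
  "pre n z = map z [0..<n]"

lemma length_pre [simp]: "length (pre n z) = n"
  and pre_0 [simp]: "pre 0 z = []"
  and pre_Suc: "pre (Suc n) z = pre n z @ [z n]"
  and butlast_pre_Suc [simp]: "butlast (pre (Suc n) z) = pre n z"
  and nth_pre [simp]: "i < n \<Longrightarrow> pre n z ! i = z i"
  by (simp_all add: pre_def)

lemma pre_eq_iff: "pre n z = pre n w \<longleftrightarrow> (\<forall>i<n. z i = w i)"
  by (auto simp: pre_def)

lemma pre_mono: "pre n z = pre n w \<Longrightarrow> m \<le> n \<Longrightarrow> pre m z = pre m w"
  by (auto simp: pre_eq_iff)

text \<open>A basic open set of the product restricts finitely many coordinates, and
  \<open>n\<close> is a bound on these.\<close>

lemma open_contains_cylinder:
  fixes U :: "(nat \<Rightarrow> 'a::discrete_topology) set"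
  assumes "open U" "x \<in> U"
  obtains n where "\<And>y. pre n y = pre n x \<Longrightarrow> y \<in> U"
proof -
  obtain V where V: "finite {i. V i \<noteq> (UNIV :: 'a set)}" "x \<in> Pi\<^sub>E UNIV V" "Pi\<^sub>E UNIV V \<subseteq> U"
    using assms unfolding open_fun_def openin_product_topology_alt by force
  obtain n where n: "\<And>i. V i \<noteq> UNIV \<Longrightarrow> i < n"
    using V(1) finite_nat_set_iff_bounded by auto
  show thesis
  proof (rule that[of n])
    fix y assume "pre n y = pre n x"
    then have "y \<in> Pi\<^sub>E UNIV V"
      using V(2) n by (auto simp: pre_eq_iff PiE_iff) (metis UNIV_I)
    then show "y \<in> U" using V(3) by auto
  qed
qed

lemma pre_limit_in_closed:
  fixes T :: "(nat \<Rightarrow> 'a::discrete_topology) set"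
  assumes "closed T" "\<And>n. \<exists>t\<in>T. pre n t = pre n x"
  shows "x \<in> T"
proof (rule ccontr)
  assume "x \<notin> T"
  then obtain n where "\<And>y. pre n y = pre n x \<Longrightarrow> y \<in> - T"
    using open_contains_cylinder[of "- T" x] assms(1) by auto
  then show False using assms(2) by blast
qed

text \<open>Every step copies the given sequence as long as this stays in the tree of \<open>T\<close>, and otherwise
  moves to some child in the tree; the result depends on finitely many entries at a time and fixes
  \<open>T\<close> pointwise.\<close>

lemma closed_retract:
  fixes T :: "(nat \<Rightarrow> 'a::discrete_topology) set"
  assumes T: "closed T" "T \<noteq> {}"
  obtains r :: "(nat \<Rightarrow> 'a) \<Rightarrow> nat \<Rightarrow> 'a" where "continuous_on UNIV r" "range r = T"
proof -
  \<comment> \<open>The lists satisfying \<open>ok\<close> form the tree of \<open>T\<close>.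
    \<open>R x n\<close> collects the first \<open>n\<close> entries of the output, which never
    leave this tree.\<close>
  define ok where "ok u = (\<exists>t\<in>T. pre (length u) t = u)" for u
  define stp where "stp u a = (if ok (u @ [a]) then a else SOME b. ok (u @ [b]))" for u a
  define R where "R = (\<lambda>x. rec_nat [] (\<lambda>n u. u @ [stp u (x n)]))"
  define r where "r x n = stp (R x n) (x n)" for x n
  have R0: "R x 0 = []" and RS: "R x (Suc n) = R x n @ [r x n]" for x n
    by (simp_all add: R_def r_def)
  have R: "R x n = pre n (r x)" for x n
    by (induction n) (simp_all add: R0 RS pre_Suc)
  have okR: "ok (R x n)" for x n
  proof (induction n)
    case 0 show ?case using T by (auto simp: ok_def R0)
  next
    case (Suc n)
    then obtain t where t: "t \<in> T" "pre n t = R x n" by (auto simp: ok_def R)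
    then have "ok (R x n @ [t n])"
      by (auto simp: ok_def R pre_Suc[symmetric] intro!: bexI[of _ t]) (simp add: pre_Suc)
    then have "ok (R x n @ [stp (R x n) (x n)])"
      by (auto simp: stp_def intro: someI)
    then show ?case by (simp add: RS r_def)
  qed
  have "r x \<in> T" for x
    by (rule pre_limit_in_closed[OF T(1)]) (use okR[of x] in \<open>auto simp: ok_def R\<close>)
  moreover have "r x = x" if "x \<in> T" for x
  proof -
    have "R x n = pre n x" for n
    proof (induction n)
      case (Suc n)
      have "ok (pre n x @ [x n])"
        using that by (auto simp: ok_def pre_Suc intro!: bexI[of _ x])
      then show ?case using Suc by (simp add: RS r_def stp_def pre_Suc)
    qed (simp add: R0)
    then show ?thesis
      by (metis R RS nth_append_length length_pre nth_pre lessI ext)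
  qed
  ultimately have "range r = T"
    by (auto simp: image_iff) metis
  moreover have "continuous_on UNIV r"
  proof (rule continuous_on_coordinatewise_then_product)
    fix n
    have loc: "pre m x = pre m y \<Longrightarrow> R x m = R y m" for x y m
      by (induction m) (auto simp: R0 RS r_def pre_Suc)
    \<comment> \<open>Entry \<open>n\<close> of the output is determined by the first
      \<open>n + 1\<close> entries of the input, so the fibres are unions of cylinders.\<close>
    have rn: "r x n = r y n" if "pre (Suc n) x = pre (Suc n) y" for x y
      using that loc[of n x y] by (auto simp: r_def pre_Suc)
    have "open {x. r x n = b}" for b
    proof -
      have eq: "{x. r x n = b} = (\<Union>y\<in>{y. r y n = b}. {x. pre (Suc n) x = pre (Suc n) y})"
        by (auto dest: rn)
      have "open {x. pre (Suc n) x = pre (Suc n) y}" for y :: "nat \<Rightarrow> 'a"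
      proof -
        have "{x. pre (Suc n) x = pre (Suc n) y} = (\<Inter>i<Suc n. {x. x i = y i})"
          by (auto simp only: pre_eq_iff INT_iff lessThan_iff mem_Collect_eq)
        then show ?thesis by (auto intro!: open_fibre)
      qed
      then show ?thesis by (subst eq) (simp add: open_UN)
    qed
    then show "continuous_on UNIV (\<lambda>x. r x n)"
      by (intro continuous_on_discreteI)
  qed
  ultimately show thesis by (intro that)
qed

section \<open>Closure properties of analytic sets\<close>

lemma analytic_closed_image:
  fixes g :: "(nat \<Rightarrow> nat) \<Rightarrow> 'a::topological_space"
  assumes "closed T" "continuous_on UNIV g"
  shows "analytic (g ` T)"
proof (cases "T = {}")
  case False
  \<comment> \<open>Precomposing with a retraction onto \<open>T\<close> replaces the closed domain
    by the whole sequence space.\<close>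
  with assms(1) obtain r :: "(nat \<Rightarrow> nat) \<Rightarrow> nat \<Rightarrow> nat"
    where r: "continuous_on UNIV r" "range r = T"
    by (rule closed_retract)
  have "continuous_on UNIV (g \<circ> r)"
    using r(1) continuous_on_subset[OF assms(2)] by (intro continuous_on_compose) auto
  moreover have "(g \<circ> r) ` UNIV = g ` T"
    using r(2) by (metis image_comp)
  ultimately show ?thesis unfolding analytic_def by blast
qed (simp add: analytic_def)

lemma analytic_image:
  assumes "analytic S" "continuous_on UNIV g"
  shows "analytic (g ` S)"
proof (cases "S = {}")
  case False
  with assms(1) obtain f :: "(nat \<Rightarrow> nat) \<Rightarrow> 'a" where f: "continuous_on UNIV f" "range f = S"
    by (auto simp: analytic_def)
  have "continuous_on UNIV (g \<circ> f)"
    using f(1) continuous_on_subset[OF assms(2)] by (intro continuous_on_compose) auto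
  then have "analytic ((g \<circ> f) ` UNIV)"
    by (intro analytic_closed_image) auto
  then show ?thesis using f(2) by (metis image_comp)
qed (simp add: analytic_def)

text \<open>The first assumption replaces the Hausdorff property: \<^typ>\<open>code\<close> is not an instance of
  \<^class>\<open>t2_space\<close>, because the library has no metric on \<^typ>\<open>bool\<close>.\<close>

lemma analytic_Int:
  fixes S :: "'a::topological_space set"
  assumes eq: "\<And>f g :: (nat \<Rightarrow> nat) \<Rightarrow> 'a. continuous_on UNIV f \<Longrightarrow> continuous_on UNIV g \<Longrightarrow> closed {\<alpha>. f \<alpha> = g \<alpha>}"
    and "analytic S" "analytic S'"
  shows "analytic (S \<inter> S')"
proof (cases "S = {} \<or> S' = {}")
  case False
  obtain f g :: "(nat \<Rightarrow> nat) \<Rightarrow> 'a" where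
    f: "continuous_on UNIV f" "range f = S" and g: "continuous_on UNIV g" "range g = S'"
    using assms False by (auto simp: analytic_def)
  \<comment> \<open>One sequence carries a parameter for each set, in its even and in its odd
    entries; the pairs of parameters with equal values form a closed set.\<close>
  define ev od :: "(nat \<Rightarrow> nat) \<Rightarrow> nat \<Rightarrow> nat"
    where "ev = (\<lambda>\<alpha> n. \<alpha> (2 * n))" and "od = (\<lambda>\<alpha> n. \<alpha> (2 * n + 1))"
  have "continuous_on UNIV ev" "continuous_on UNIV od"
    unfolding ev_def od_def by (intro continuous_intros continuous_on_product_coordinates)+
  then have cf: "continuous_on UNIV (\<lambda>\<alpha>. f (ev \<alpha>))" and cg: "continuous_on UNIV (\<lambda>\<alpha>. g (od \<alpha>))"
    by (auto intro: continuous_on_compose2[OF f(1)] continuous_on_compose2[OF g(1)])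
  let ?T = "{\<alpha>. f (ev \<alpha>) = g (od \<alpha>)}"
  have "S \<inter> S' \<subseteq> (\<lambda>\<alpha>. f (ev \<alpha>)) ` ?T"
  proof
    fix x assume "x \<in> S \<inter> S'"
    then obtain \<beta> \<gamma> where "x = f \<beta>" "x = g \<gamma>"
      using f(2) g(2) by (metis Int_iff imageE)
    moreover define \<alpha> where "\<alpha> n = (if even n then \<beta> (n div 2) else \<gamma> (n div 2))" for n
    have "ev \<alpha> = \<beta>" "od \<alpha> = \<gamma>" by (auto simp: ev_def od_def \<alpha>_def)
    ultimately show "x \<in> (\<lambda>\<alpha>. f (ev \<alpha>)) ` ?T"
      by (intro image_eqI[of _ _ \<alpha>]) auto
  qed
  moreover have "(\<lambda>\<alpha>. f (ev \<alpha>)) ` ?T \<subseteq> S \<inter> S'"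
    using f(2) g(2) by (auto simp: image_iff) metis
  moreover have "closed ?T" by (rule eq[OF cf cg])
  ultimately show ?thesis
    using analytic_closed_image[OF _ cf, of ?T] by (metis subset_antisym)
qed (auto simp: analytic_def)

text \<open>A sequence codes eight binary functions, which serve as the operations of two groups together
  with a homomorphism and a right inverse of it.\<close>

definition slot :: "(nat \<Rightarrow> nat) \<Rightarrow> nat \<Rightarrow> nat \<Rightarrow> nat \<Rightarrow> nat" where
  "slot \<alpha> k a b = \<alpha> (to_nat (k, a, b))"

lemma continuous_on_slot [continuous_intros]:
  assumes "continuous_on UNIV f" "continuous_on UNIV g"
  shows "continuous_on UNIV (\<lambda>\<alpha>. slot \<alpha> k (f \<alpha>) (g \<alpha>))"
  unfolding slot_def
  by (intro continuous_on_apply continuous_on_discrete2[where H = "\<lambda>a b. to_nat (k, a, b)"] assms)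

text \<open>Three consecutive slots hold product, unit and inverse. Arguments fixed to 0 are
  dummies, since slots are binary throughout.\<close>

definition slot_law :: "(nat \<Rightarrow> nat) \<Rightarrow> nat \<Rightarrow> bool" where
  "slot_law \<alpha> k \<longleftrightarrow>
     group_law (slot \<alpha> k) (slot \<alpha> (Suc k) 0 0) (\<lambda>a. slot \<alpha> (Suc (Suc k)) a 0)"

lemma closed_slot_law: "closed {\<alpha>. slot_law \<alpha> k}"
  unfolding slot_law_def group_law_def
  by (intro closed_Collect_conj closed_Collect_all closed_Collect_eq continuous_intros)

lemma ex_slots: "\<exists>\<alpha>. \<forall>k a b. slot \<alpha> k a b = F k a b"
  by (rule exI[of _ "\<lambda>n. case from_nat n of (k, a, b) \<Rightarrow> F k a b"]) (simp add: slot_def)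

lemma analytic_epi_rel: "analytic epi_rel"
proof -
  \<comment> \<open>Slots 0 to 2 hold the target group, 3 to 5 the source, 6 the homomorphism and 7
    a section of it. The section replaces the existential in surjectivity by an equation, so
    \<open>T\<close> is closed.\<close>
  define T where "T = {\<alpha>. slot_law \<alpha> 0 \<and> slot_law \<alpha> 3 \<and>
      (\<forall>a b. slot \<alpha> 6 (slot \<alpha> 3 a b) 0 = slot \<alpha> 0 (slot \<alpha> 6 a 0) (slot \<alpha> 6 b 0)) \<and>
      (\<forall>a. slot \<alpha> 6 (slot \<alpha> 7 a 0) 0 = a)}"
  define g where "g \<alpha> = (graph_code (slot \<alpha> 0), graph_code (slot \<alpha> 3))" for \<alpha>
  have "closed T"
    unfolding T_def
    by (intro closed_Collect_conj closed_slot_law closed_Collect_all closed_Collect_eq continuous_intros)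
  moreover have "continuous_on UNIV g"
  proof -
    have "continuous_on UNIV (\<lambda>\<alpha>. graph_code (slot \<alpha> k))" for k
    proof (rule continuous_on_coordinatewise_then_product)
      fix p :: "nat \<times> nat \<times> nat"
      obtain a b d where p: "p = (a, b, d)" by (cases p)
      show "continuous_on UNIV (\<lambda>\<alpha>. graph_code (slot \<alpha> k) p)"
        unfolding p graph_code_def prod.case
        by (intro continuous_on_discrete2[where H = "(=)"] continuous_intros)
    qed
    then show ?thesis unfolding g_def by (intro continuous_on_Pair)
  qed
  moreover have "g ` T = epi_rel"
  proof (intro subset_antisym subsetI)
    fix p assume "p \<in> g ` T"
    then obtain \<alpha> where \<alpha>: "\<alpha> \<in> T" "p = g \<alpha>" by auto
    then show "p \<in> epi_rel"
      unfolding g_def by (auto simp: epi_rel_iff T_def slot_law_def surj_def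
          intro!: graph_code_in_group_codes exI[of _ "\<lambda>a. slot \<alpha> 6 a 0"]) metis
  next
    fix p assume p: "p \<in> epi_rel"
    obtain A B where AB: "p = (A, B)" by (cases p)
    then obtain h where h: "\<And>a b. h (code_mult B a b) = code_mult A (h a) (h b)" "surj h"
      and "A \<in> group_codes" "B \<in> group_codes"
      using p by (auto simp: epi_rel_iff)
    then obtain e i e' i' where A: "A = graph_code (code_mult A)" "group_law (code_mult A) e i"
      and B: "B = graph_code (code_mult B)" "group_law (code_mult B) e' i'"
      by (metis group_codesE)
    define F where "F k a b = [code_mult A a b, e, i a, code_mult B a b, e', i' a, h a, inv_into UNIV h a] ! k" for k a b
    obtain \<alpha> where \<alpha>: "\<And>k a b. slot \<alpha> k a b = F k a b"
      using ex_slots[of F] by auto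
    have slot: "slot \<alpha> 0 = code_mult A" "slot \<alpha> 3 = code_mult B"
      "\<And>a b. slot \<alpha> (Suc 0) a b = e" "\<And>a b. slot \<alpha> 2 a b = i a"
      "\<And>a b. slot \<alpha> 4 a b = e'" "\<And>a b. slot \<alpha> 5 a b = i' a"
      "\<And>a b. slot \<alpha> 6 a b = h a" "\<And>a b. slot \<alpha> 7 a b = inv_into UNIV h a"
      by (simp_all add: fun_eq_iff \<alpha> F_def)
    have "\<alpha> \<in> T"
      using A(2) B(2) h by (simp add: T_def slot_law_def slot surj_f_inv_f flip: numeral_2_eq_2)
    moreover have "g \<alpha> = p"
      using A(1) B(1) by (simp add: g_def slot AB)
    ultimately show "p \<in> g ` T" by auto
  qed
  ultimately show ?thesis using analytic_closed_image by metis
qed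

lemma analytic_biepi_rel: "analytic biepi_rel"
  unfolding biepi_rel_eq
proof (rule analytic_Int)
  fix f g :: "(nat \<Rightarrow> nat) \<Rightarrow> code \<times> code"
  assume "continuous_on UNIV f" "continuous_on UNIV g"
  then have "continuous_on UNIV (\<lambda>\<alpha>. fst (f \<alpha>) p)" "continuous_on UNIV (\<lambda>\<alpha>. fst (g \<alpha>) p)"
    "continuous_on UNIV (\<lambda>\<alpha>. snd (f \<alpha>) p)" "continuous_on UNIV (\<lambda>\<alpha>. snd (g \<alpha>) p)" for p
    by (auto intro: continuous_on_compose2[OF continuous_on_product_coordinates[of p]]
        continuous_on_fst continuous_on_snd)
  then have "closed {\<alpha>. \<forall>p. fst (f \<alpha>) p = fst (g \<alpha>) p \<and> snd (f \<alpha>) p = snd (g \<alpha>) p}"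
    by (intro closed_Collect_all closed_Collect_conj closed_Collect_eq)
  moreover have "{\<alpha>. \<forall>p. fst (f \<alpha>) p = fst (g \<alpha>) p \<and> snd (f \<alpha>) p = snd (g \<alpha>) p} = {\<alpha>. f \<alpha> = g \<alpha>}"
    by (simp add: prod_eq_iff fun_eq_iff all_conj_distrib)
  ultimately show "closed {\<alpha>. f \<alpha> = g \<alpha>}" by simp
next
  show "analytic (prod.swap ` epi_rel)"
    unfolding prod.swap_def[abs_def]
    by (intro analytic_image analytic_epi_rel continuous_on_Pair
        continuous_on_fst continuous_on_snd continuous_on_id)
qed (rule analytic_epi_rel)

section \<open>Codes of countable abelian groups\<close>

definition add_subgroup :: "'v::ab_group_add set \<Rightarrow> bool" where
  "add_subgroup G \<longleftrightarrow> 0 \<in> G \<and> (\<forall>a\<in>G. \<forall>b\<in>G. a + b \<in> G) \<and> (\<forall>a\<in>G. - a \<in> G)"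

text \<open>Listing the elements by increasing code, instead of by an arbitrary bijection, makes the
  \<open>n\<close>-th element a measurable function of \<open>G\<close>.\<close>

definition elt :: "'v::countable set \<Rightarrow> nat \<Rightarrow> 'v" where
  "elt G n = from_nat (enumerate (to_nat ` G) n)"

definition code_of :: "'v::{countable, ab_group_add} set \<Rightarrow> code" where
  "code_of G = (\<lambda>(a, b, d). elt G a + elt G b = elt G d)"

lemma bij_betw_elt:
  fixes G :: "'v::countable set"
  assumes "infinite G"
  shows "bij_betw (elt G) UNIV G"
proof -
  have "infinite (to_nat ` G)"
    using assms by (simp add: finite_image_iff)
  then have "bij_betw (enumerate (to_nat ` G)) UNIV (to_nat ` G)"
    by (rule bij_enumerate)
  moreover have "bij_betw from_nat (to_nat ` G) G"
    by (rule bij_betw_byWitness[where f' = to_nat]) auto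
  ultimately have "bij_betw (from_nat \<circ> enumerate (to_nat ` G)) UNIV G"
    by (rule bij_betw_trans)
  then show ?thesis
    by (simp add: elt_def[abs_def] comp_def)
qed

lemma code_of_props:
  fixes G :: "'v::{countable, ab_group_add} set"
  assumes G: "add_subgroup G" "infinite G"
  shows code_of_in_group_codes: "code_of G \<in> group_codes"
    and elt_code_mult: "elt G (code_mult (code_of G) a b) = elt G a + elt G b"
proof -
  define nr where "nr = inv_into UNIV (elt G)"
  have bij: "bij_betw (elt G) UNIV G" by (rule bij_betw_elt) fact
  have mem: "elt G n \<in> G" for n using bij by (auto simp: bij_betw_def)
  have elt_nr: "elt G (nr v) = v" if "v \<in> G" for v
    unfolding nr_def using bij that by (rule bij_betw_inv_into_right)
  have nr_eq: "nr v = n \<longleftrightarrow> v = elt G n" if "v \<in> G" for v n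
    using elt_nr[OF that] bij_betw_inv_into_left[OF bij, of n] by (auto simp: nr_def)
  define m where "m a b = nr (elt G a + elt G b)" for a b
  have elt_m: "elt G (m a b) = elt G a + elt G b" for a b
    using G(1) mem by (auto simp: m_def add_subgroup_def intro!: elt_nr)
  have eq: "code_of G = graph_code m"
    using G(1) mem by (auto simp: code_of_def graph_code_def m_def add_subgroup_def fun_eq_iff nr_eq)
  have inj: "a = b" if "elt G a = elt G b" for a b
    using bij that by (auto simp: bij_betw_def inj_def)
  have minus: "- v \<in> G" if "v \<in> G" for v
    using G(1) that by (auto simp: add_subgroup_def)
  have "group_law m (nr 0) (\<lambda>a. nr (- elt G a))"
    unfolding group_law_def
    by (intro conjI allI inj)
       (use G(1) in \<open>auto simp: elt_m elt_nr add.assoc mem minus add_subgroup_def\<close>)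
  then show "code_of G \<in> group_codes"
    unfolding eq by (rule graph_code_in_group_codes)
  show "elt G (code_mult (code_of G) a b) = elt G a + elt G b"
    by (simp add: eq elt_m)
qed

text \<open>Conjugation with the numberings \<open>elt\<close> translates between maps on indices
  and maps on vectors. The map \<psi> is total, but only its behaviour on \<open>H\<close>
  counts.\<close>

lemma epi_rel_code_of_iff:
  fixes G H :: "'v::{countable, ab_group_add} set"
  assumes G: "add_subgroup G" "infinite G" and H: "add_subgroup H" "infinite H"
  shows "(code_of G, code_of H) \<in> epi_rel \<longleftrightarrow>
    (\<exists>\<psi>. (\<forall>a\<in>H. \<forall>b\<in>H. \<psi> (a + b) = \<psi> a + \<psi> b) \<and> \<psi> ` H = G)"
proof -
  define g where "g = inv_into UNIV (elt G)"
  define h where "h = inv_into UNIV (elt H)"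
  have bG: "bij_betw (elt G) UNIV G" and bH: "bij_betw (elt H) UNIV H"
    by (rule bij_betw_elt, fact)+
  have rG: "range (elt G) = G" and rH: "range (elt H) = H"
    using bG bH by (auto simp: bij_betw_def)
  have g: "elt G (g v) = v" if "v \<in> G" for v
    unfolding g_def using bG that by (rule bij_betw_inv_into_right)
  have h: "elt H (h v) = v" if "v \<in> H" for v
    unfolding h_def using bH that by (rule bij_betw_inv_into_right)
  have g': "g (elt G n) = n" and h': "h (elt H n) = n" for n
    unfolding g_def h_def using bG bH by (simp_all add: bij_betw_inv_into_left)
  have addG: "a + b \<in> G" if "a \<in> G" "b \<in> G" for a b
    using that G(1) by (auto simp: add_subgroup_def)
  have addH: "a + b \<in> H" if "a \<in> H" "b \<in> H" for a b
    using that H(1) by (auto simp: add_subgroup_def)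
  have memG: "elt G n \<in> G" and memH: "elt H n \<in> H" for n
    using rG rH by auto
  have mG: "code_mult (code_of G) a b = g (elt G a + elt G b)" for a b
    by (metis elt_code_mult[OF G] g')
  have mH: "code_mult (code_of H) a b = h (elt H a + elt H b)" for a b
    by (metis elt_code_mult[OF H] h')
  show ?thesis
  proof
    assume "(code_of G, code_of H) \<in> epi_rel"
    then obtain k where k: "\<And>a b. k (code_mult (code_of H) a b) = code_mult (code_of G) (k a) (k b)" "surj k"
      by (auto simp: epi_rel_iff)
    define \<psi> where "\<psi> v = elt G (k (h v))" for v
    have "\<psi> (a + b) = \<psi> a + \<psi> b" if "a \<in> H" "b \<in> H" for a b
    proof -
      have "k (h (a + b)) = g (elt G (k (h a)) + elt G (k (h b)))"
        using k(1)[of "h a" "h b"] that by (simp add: mG mH h)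
      then show ?thesis by (simp add: \<psi>_def g addG memG)
    qed
    moreover have "\<psi> ` H = G"
    proof -
      have "h ` H = UNIV" by (metis UNIV_eq_I h' memH image_eqI)
      moreover have "\<psi> ` H = elt G ` (k ` (h ` H))" by (simp add: \<psi>_def[abs_def] image_image)
      ultimately show ?thesis using k(2) rG by simp
    qed
    ultimately show "\<exists>\<psi>. (\<forall>a\<in>H. \<forall>b\<in>H. \<psi> (a + b) = \<psi> a + \<psi> b) \<and> \<psi> ` H = G"
      by blast
  next
    assume "\<exists>\<psi>. (\<forall>a\<in>H. \<forall>b\<in>H. \<psi> (a + b) = \<psi> a + \<psi> b) \<and> \<psi> ` H = G"
    then obtain \<psi> where \<psi>: "\<And>a b. a \<in> H \<Longrightarrow> b \<in> H \<Longrightarrow> \<psi> (a + b) = \<psi> a + \<psi> b" "\<psi> ` H = G"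
      by blast
    define k where "k n = g (\<psi> (elt H n))" for n
    have "k (code_mult (code_of H) a b) = code_mult (code_of G) (k a) (k b)" for a b
    proof -
      have "\<psi> (elt H a) \<in> G" "\<psi> (elt H b) \<in> G" using \<psi>(2) memH by auto
      then show ?thesis by (simp add: k_def mG mH h addH memH \<psi>(1) g)
    qed
    moreover have "surj k"
    proof -
      have "range k = g ` (\<psi> ` range (elt H))" by (auto simp: k_def)
      also have "\<dots> = UNIV" unfolding rH \<psi>(2) by (metis UNIV_eq_I g' memG image_eqI)
      finally show ?thesis .
    qed
    ultimately show "(code_of G, code_of H) \<in> epi_rel"
      unfolding epi_rel_iff using code_of_in_group_codes G H by blast
  qed
qed

section \<open>Measurability of the code of a group\<close>

lemma measurable_enumerate:
  fixes S :: "'x \<Rightarrow> nat set"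
  assumes inf: "\<And>x. infinite (S x)" and S: "\<And>k. {x \<in> space M. k \<in> S x} \<in> sets M"
  shows "(\<lambda>x. enumerate (S x) n) \<in> measurable M (count_space UNIV)"
proof (induction n)
  have [measurable]: "Measurable.pred M (\<lambda>x. k \<in> S x)" for k
    unfolding pred_def by (rule S)
  {
    case 0
    show ?case unfolding enumerate_0 by measurable
  next
    case (Suc n)
    note [measurable] = Suc
    \<comment> \<open>The next element is the least one above the previous element, and the least
      index of a sequence of measurable conditions is measurable.\<close>
    show ?case unfolding enumerate_Suc''[OF inf] by measurable
  }
qed

text \<open>A countable base allows measurability of maps into the space of codes to be checked
  coordinatewise.\<close>

instance bool :: second_countable_topology
proof
  have "open = generate_topology (UNIV :: bool set set)"
    by (intro ext) (auto intro: generate_topology.Basis Topological_Spaces.open_discrete)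
  then show "\<exists>B :: bool set set. countable B \<and> open = generate_topology B"
    by (intro exI[of _ UNIV]) simp
qed

lemma measurable_code_of:
  fixes G :: "'x \<Rightarrow> 'v::{countable, ab_group_add} set"
  assumes inf: "\<And>x. infinite (G x)" and G: "\<And>v. {x \<in> space M. v \<in> G x} \<in> sets M"
  shows "(\<lambda>x. code_of (G x)) \<in> measurable M borel"
proof (rule measurable_coordinatewise_then_product)
  have elt [measurable]: "(\<lambda>x. elt (G x) n) \<in> measurable M (count_space UNIV)" for n
  proof -
    have "{x \<in> space M. k \<in> to_nat ` G x} \<in> sets M" for k
    proof (cases "k \<in> range (to_nat :: 'v \<Rightarrow> nat)")
      case True
      then obtain v :: 'v where "k = to_nat v" by auto
      then have "{x \<in> space M. k \<in> to_nat ` G x} = {x \<in> space M. v \<in> G x}" by auto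
      then show ?thesis using G by simp
    next
      case False
      then have "{x \<in> space M. k \<in> to_nat ` G x} = {}" by auto
      then show ?thesis by (simp only: sets.empty_sets)
    qed
    moreover have "infinite (to_nat ` G x)" for x
      using inf by (simp add: finite_image_iff)
    ultimately have "(\<lambda>x. enumerate (to_nat ` G x) n) \<in> measurable M (count_space UNIV)"
      by (intro measurable_enumerate)
    then have "from_nat \<circ> (\<lambda>x. enumerate (to_nat ` G x) n) \<in> measurable M (count_space UNIV)"
      by (rule measurable_comp) simp
    then show ?thesis by (simp add: comp_def elt_def[abs_def])
  qed
  fix p :: "nat \<times> nat \<times> nat"
  obtain a b d where p: "p = (a, b, d)" by (cases p)
  have "Measurable.pred M (\<lambda>x. elt (G x) a + elt (G x) b = elt (G x) d)"
    by measurable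
  then show "(\<lambda>x. code_of (G x) p) \<in> measurable M borel"
    by (simp add: p code_of_def cong: measurable_cong_sets[OF refl sets_borel_eq_count_space])
qed

section \<open>Trees of approximate chains\<close>

text \<open>In \<open>Node v L\<close> all lists have the same length; the pairs in \<open>L\<close> approximate a witness and the
  next point of a chain, and the label \<open>v\<close> approximates its last point.\<close>

datatype node = Root | Node "nat list" "(nat list \<times> nat list) list"

instance node :: countable by countable_datatype

fun lab :: "node \<Rightarrow> nat list option" where
  "lab Root = None"
| "lab (Node v L) = Some v"

text \<open>All entries lose their last element simultaneously, so the number of links of the chain
  is unchanged. The nodes with empty label hang directly below \<open>Root\<close>.\<close>

fun par :: "node \<Rightarrow> node" where
  "par Root = Root"
| "par (Node v L) = (if v = [] then Root else Node (butlast v) (map (map_prod butlast butlast) L))"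

lemma lab_par_neq: "lab i \<noteq> None \<Longrightarrow> lab (par i) \<noteq> lab i"
proof (cases i)
  case (Node v L)
  then show ?thesis
    by (cases v rule: rev_cases) auto
qed auto

text \<open>Prefixing a witness keeps the label, and it commutes with \<open>par\<close>; hence it
  will respect both kinds of divisibility.\<close>

fun push :: "(nat \<Rightarrow> nat) \<Rightarrow> (nat \<Rightarrow> nat) \<Rightarrow> node \<Rightarrow> node" where
  "push \<gamma> y Root = Root"
| "push \<gamma> y (Node v L) = Node v ((pre (length v) \<gamma>, pre (length v) y) # L)"

lemma lab_push [simp]: "lab (push \<gamma> y i) = lab i"
  by (cases i) auto

lemma par_push: "par (push \<gamma> y i) = push \<gamma> y (par i)"
proof (cases i)
  case (Node v L)
  then show ?thesis by (cases v rule: rev_cases) auto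
qed auto

text \<open>This is the branch of empty chains at \<open>y\<close>. The index is shifted by one
  because \<open>Root\<close> lies above the empty label.\<close>

fun trunk :: "(nat \<Rightarrow> nat) \<Rightarrow> nat \<Rightarrow> node" where
  "trunk y 0 = Root"
| "trunk y (Suc n) = Node (pre n y) []"

lemma par_trunk_Suc [simp]: "par (trunk y (Suc n)) = trunk y n"
  by (cases n) (auto simp: pre_Suc)

lemma lab_trunk_eq_iff [simp]: "lab (trunk y m) = lab (trunk y n) \<longleftrightarrow> m = n"
  by (cases m; cases n) (auto dest: arg_cong[where f = length])

lemma ex_pre_limit:
  assumes "\<And>n. length (s n) = n" "\<And>n. s n = butlast (s (Suc n))"
  obtains z where "\<And>n. s n = pre n z"
proof -
  define z where "z n = s (Suc n) ! n" for n
  have "s n = pre n z" for n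
  proof (induction n)
    case (Suc n)
    have "s (Suc n) = butlast (s (Suc n)) @ [last (s (Suc n))]"
      using assms(1)[of "Suc n"] by (intro append_butlast_last_id[symmetric]) auto
    moreover have "last (s (Suc n)) = z n"
      using assms(1)[of "Suc n"] by (subst last_conv_nth) (auto simp: z_def)
    ultimately show ?case
      using Suc assms(2)[of n] by (simp add: pre_Suc)
  qed (use assms(1)[of 0] in auto)
  then show thesis by (rule that)
qed

text \<open>The assumption is topological closedness of \<open>C\<close> in terms of common
  prefixes.\<close>

locale closed_relation =
  fixes C :: "(nat \<Rightarrow> nat) \<Rightarrow> (nat \<Rightarrow> nat) \<Rightarrow> (nat \<Rightarrow> nat) \<Rightarrow> bool"
  assumes closed: "(\<And>n. \<exists>z' \<gamma>' w'. C z' \<gamma>' w' \<and> pre n z = pre n z' \<and> pre n \<gamma> = pre n \<gamma>' \<and> pre n w = pre n w')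
    \<Longrightarrow> C z \<gamma> w"
begin

definition R :: "(nat \<Rightarrow> nat) \<Rightarrow> (nat \<Rightarrow> nat) \<Rightarrow> bool" where
  "R z w \<longleftrightarrow> (\<exists>\<gamma>. C z \<gamma> w)"

definition link :: "nat list \<Rightarrow> nat list \<Rightarrow> nat list \<Rightarrow> bool" where
  "link u s v \<longleftrightarrow> (\<exists>z \<gamma> w n. C z \<gamma> w \<and> u = pre n z \<and> s = pre n \<gamma> \<and> v = pre n w)"

fun chain :: "nat list \<Rightarrow> (nat list \<times> nat list) list \<Rightarrow> nat list \<Rightarrow> bool" where
  "chain u [] v \<longleftrightarrow> u = v"
| "chain u ((s, t) # L) v \<longleftrightarrow> link u s t \<and> chain t L v"

fun valid :: "(nat \<Rightarrow> nat) \<Rightarrow> node \<Rightarrow> bool" where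
  "valid z Root \<longleftrightarrow> True"
| "valid z (Node v L) \<longleftrightarrow> chain (pre (length v) z) L v"

lemma link_length: "link u s v \<Longrightarrow> length s = length u \<and> length v = length u"
  by (auto simp: link_def)

lemma link_butlast: "link u s v \<Longrightarrow> link (butlast u) (butlast s) (butlast v)"
proof -
  assume "link u s v"
  then obtain z \<gamma> w n where *: "C z \<gamma> w" "u = pre n z" "s = pre n \<gamma>" "v = pre n w"
    by (auto simp: link_def)
  have "butlast (pre n x) = pre (n - 1) x" for x :: "nat \<Rightarrow> nat"
    by (cases n) auto
  with * show ?thesis by (auto simp: link_def)
qed

lemma chain_butlast: "chain u L v \<Longrightarrow> chain (butlast u) (map (map_prod butlast butlast) L) (butlast v)"
  by (induction u L v rule: chain.induct) (auto intro: link_butlast)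

lemma valid_par: "valid z i \<Longrightarrow> valid z (par i)"
proof (cases i)
  case (Node v L)
  assume "valid z i"
  with Node have "chain (butlast (pre (length v) z)) (map (map_prod butlast butlast) L) (butlast v)"
    using chain_butlast by simp
  then show ?thesis
    using Node by (cases v rule: rev_cases) auto
qed auto

lemma valid_push: "C x \<gamma> y \<Longrightarrow> valid y i \<Longrightarrow> valid x (push \<gamma> y i)"
  by (cases i) (auto simp: link_def)

lemma valid_trunk [simp]: "valid y (trunk y n)"
  by (cases n) auto

text \<open>Truncation preserves the number of links, so it is constant along the branch and can
  serve for induction. The entries of the first link converge to a witness and a next point, which
  satisfy \<open>C\<close> by closedness.\<close>

lemma chain_limit:
  assumes "\<And>n. chain (pre n z) (L n) (pre n y)"
    and "\<And>n. L n = map (map_prod butlast butlast) (L (Suc n))"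
  shows "R\<^sup>*\<^sup>* z y"
proof -
  have "length (L (Suc n)) = length (L n)" for n
    using arg_cong[OF assms(2)[of n], of length] by simp
  then have "length (L n) = length (L 0)" for n
    by (induction n) auto
  then obtain k where "\<And>n. length (L n) = k" by blast
  then show ?thesis using assms
  proof (induction k arbitrary: z L)
    case 0
    then have "pre n z = pre n y" for n
      by (metis chain.simps(1) length_0_conv)
    then have "z = y" by (metis ext lessI pre_eq_iff)
    then show ?case by simp
  next
    case (Suc k)
    define s where "s n = fst (hd (L n))" for n
    define t where "t n = snd (hd (L n))" for n
    define L' where "L' n = tl (L n)" for n
    have L: "L n = (s n, t n) # L' n" for n
      using Suc.prems(1)[of n] by (cases "L n") (auto simp: s_def t_def L'_def)
    have ch: "link (pre n z) (s n) (t n)" "chain (t n) (L' n) (pre n y)" for n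
      using Suc.prems(2)[of n] by (auto simp: L)
    have cut: "s n = butlast (s (Suc n))" "t n = butlast (t (Suc n))"
      "L' n = map (map_prod butlast butlast) (L' (Suc n))" for n
      using Suc.prems(3)[of n] by (auto simp: L)
    have len: "length (s n) = n" "length (t n) = n" for n
      using link_length[OF ch(1)[of n]] by auto
    obtain \<gamma> where \<gamma>: "\<And>n. s n = pre n \<gamma>" using ex_pre_limit len(1) cut(1) by blast
    obtain w where w: "\<And>n. t n = pre n w" using ex_pre_limit len(2) cut(2) by blast
    have "C z \<gamma> w"
    proof (rule closed)
      fix n
      have "link (pre n z) (pre n \<gamma>) (pre n w)" using ch(1)[of n] by (simp add: \<gamma> w)
      then show "\<exists>z' \<gamma>' w'. C z' \<gamma>' w' \<and> pre n z = pre n z' \<and> pre n \<gamma> = pre n \<gamma>' \<and> pre n w = pre n w'"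
        unfolding link_def by (metis length_pre)
    qed
    then have "R z w" by (auto simp: R_def)
    moreover have "R\<^sup>*\<^sup>* w y"
    proof (rule Suc.IH)
      show "length (L' n) = k" for n using Suc.prems(1)[of n] by (simp add: L)
      show "chain (pre n w) (L' n) (pre n y)" for n using ch(2)[of n] by (simp add: w)
    qed (rule cut(3))
    ultimately show ?case by simp
  qed
qed

lemma branch_imp_chain:
  assumes "\<And>n. valid x (i n)" "\<And>n. par (i (Suc n)) = i n" "\<And>n. lab (i n) = lab (trunk y n)"
  shows "R\<^sup>*\<^sup>* x y"
proof -
  have "\<exists>L. i (Suc n) = Node (pre n y) L" for n
    using assms(3)[of "Suc n"] by (cases "i (Suc n)") auto
  then obtain L where L: "\<And>n. i (Suc n) = Node (pre n y) (L n)"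
    by metis
  show ?thesis
  proof (rule chain_limit)
    show "chain (pre n x) (L n) (pre n y)" for n
      using assms(1)[of "Suc n"] by (simp add: L)
    show "L n = map (map_prod butlast butlast) (L (Suc n))" for n
      using assms(2)[of "Suc n"] by (auto simp: L pre_Suc)
  qed
qed

end

section \<open>Localisation and finitely supported vectors\<close>

text \<open>A vector is recovered from the finite association list of its nonzero
  coefficients.\<close>

instance poly_mapping :: (countable, "{zero, countable}") countable
proof
  define ls where "ls = (\<lambda>p :: 'a \<Rightarrow>\<^sub>0 'b. SOME ks. set ks = keys p)"
  define enc where "enc p = map (\<lambda>k. (k, lookup p k)) (ls p)" for p :: "'a \<Rightarrow>\<^sub>0 'b"
  have ls: "set (ls p) = keys p" for p
    unfolding ls_def by (rule someI_ex) (rule finite_list[OF finite_keys])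
  have "lookup p k = (case map_of (enc p) k of None \<Rightarrow> 0 | Some c \<Rightarrow> c)" for p k
    unfolding enc_def map_of_map_restrict by (auto simp: ls restrict_map_def in_keys_iff)
  then have "inj enc"
    by (metis injI poly_mapping_eqI)
  then show "\<exists>f :: ('a \<Rightarrow>\<^sub>0 'b) \<Rightarrow> nat. inj f"
    by (intro exI[of _ "to_nat \<circ> enc"] inj_compose) auto
qed

section \<open>Additive maps given on coordinates, and natural multiples\<close>

definition ext :: "('k \<Rightarrow> 'b::zero \<Rightarrow> 'c::comm_monoid_add) \<Rightarrow> ('k \<Rightarrow>\<^sub>0 'b) \<Rightarrow> 'c" where
  "ext f v = (\<Sum>k\<in>keys v. f k (lookup v k))"

lemma ext_single: "f k 0 = 0 \<Longrightarrow> ext f (single k c) = f k c"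
  by (simp add: ext_def)

lemma additive_ext:
  fixes f :: "'k \<Rightarrow> 'b::ab_group_add \<Rightarrow> 'c::ab_group_add"
  assumes "\<And>k. additive (f k)"
  shows "additive (ext f)"
proof
  fix u v :: "'k \<Rightarrow>\<^sub>0 'b"
  have f0: "f k 0 = 0" for k by (rule additive.zero[OF assms])
  \<comment> \<open>Both vectors and their sum are summed over one common finite set; the additional
    terms vanish by \<open>f0\<close>.\<close>
  have *: "ext f w = (\<Sum>k\<in>keys u \<union> keys v. f k (lookup w k))" if "keys w \<subseteq> keys u \<union> keys v" for w
    unfolding ext_def using that f0
    by (intro sum.mono_neutral_left) (auto simp: in_keys_iff)
  have "keys (u + v) \<subseteq> keys u \<union> keys v" by (rule keys_add)
  then show "ext f (u + v) = ext f u + ext f v"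
    by (simp add: * lookup_add additive.add[OF assms] sum.distrib)
qed

lemma additive_lookup: "additive (\<lambda>v :: 'k \<Rightarrow>\<^sub>0 'b::ab_group_add. lookup v k)"
  by standard (simp add: lookup_add)

definition nsm :: "nat \<Rightarrow> 'v::comm_monoid_add \<Rightarrow> 'v" where
  "nsm n v = (\<Sum>j<n. v)"

lemma nsm_0 [simp]: "nsm 0 v = 0" and nsm_Suc: "nsm (Suc n) v = nsm n v + v"
  by (simp_all add: nsm_def add.commute)

lemma additive_nsm:
  fixes \<theta> :: "'v::ab_group_add \<Rightarrow> rat"
  assumes "additive \<theta>" shows "\<theta> (nsm n v) = of_nat n * \<theta> v"
  by (induction n) (simp_all add: nsm_Suc additive.zero[OF assms] additive.add[OF assms] algebra_simps)

lemma nsm_additive: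
  fixes f :: "rat \<Rightarrow> 'v::ab_group_add"
  assumes "additive f" shows "nsm n (f c) = f (of_nat n * c)"
  by (induction n) (simp_all add: nsm_Suc additive.zero[OF assms] flip: additive.add[OF assms], simp add: algebra_simps)

lemma additive_single: "additive (\<lambda>c :: 'b::ab_group_add. single k c)"
  by standard (simp add: single_add)

section \<open>The localisation Z_(p), which is \<open>pint p\<close>, and the ring Z[1/p], which is
  \<open>fracs p\<close>\<close>

definition pint :: "nat \<Rightarrow> rat set" where
  "pint p = {x. \<exists>q m :: int. \<not> int p dvd q \<and> x * of_int q = of_int m}"

lemma pintI: "\<not> int p dvd q \<Longrightarrow> x * of_int q = of_int m \<Longrightarrow> x \<in> pint p"
  by (auto simp: pint_def)

lemma pint_of_int [simp]: "prime p \<Longrightarrow> of_int m \<in> pint p"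
  by (rule pintI[of _ 1 _ m]) auto

lemma pint_0 [simp]: "prime p \<Longrightarrow> 0 \<in> pint p"
  using pint_of_int[of p 0] by simp

lemma pint_add:
  assumes "prime p" "x \<in> pint p" "y \<in> pint p" shows "x + y \<in> pint p"
proof -
  obtain q m q' m' :: int where *: "\<not> int p dvd q" "x * of_int q = of_int m"
    "\<not> int p dvd q'" "y * of_int q' = of_int m'"
    using assms(2,3) by (auto simp: pint_def)
  have "(x + y) * of_int (q * q') = (x * of_int q) * of_int q' + (y * of_int q') * of_int q"
    by (simp add: algebra_simps)
  also have "\<dots> = of_int (m * q' + m' * q)" by (simp add: *)
  finally show ?thesis
    using *(1,3) assms(1) by (intro pintI[of _ "q * q'" _ "m * q' + m' * q"]) (simp_all add: prime_dvd_mult_iff)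
qed

lemma pint_mult_int:
  assumes "x \<in> pint p" shows "of_int k * x \<in> pint p"
proof -
  obtain q m :: int where "\<not> int p dvd q" "x * of_int q = of_int m"
    using assms by (auto simp: pint_def)
  then have "\<not> int p dvd q" "of_int k * x * of_int q = of_int (k * m)"
    by simp_all
  then show ?thesis unfolding pint_def by blast
qed

definition fracs :: "nat \<Rightarrow> rat set" where
  "fracs p = {of_int m / of_nat (p ^ n) | m n. True}"

lemma fracsI: "c = of_int m / of_nat (p ^ n) \<Longrightarrow> c \<in> fracs p"
  by (auto simp: fracs_def)

lemma fracsE:
  assumes "c \<in> fracs p" obtains m n where "c = of_int m / of_nat (p ^ n)"
  using assms by (auto simp: fracs_def)

text \<open>A power of another prime is a unit in Z_(p).\<close>

lemma fracs_in_pint: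
  assumes "prime p" "prime p'" "p \<noteq> p'" "c \<in> fracs p'"
  shows "c \<in> pint p"
proof -
  obtain m n where c: "c = of_int m / of_nat (p' ^ n)"
    using assms(4) by (auto simp: fracs_def)
  have "\<not> p dvd p' ^ n"
    using assms(1-3) by (metis prime_dvd_power primes_dvd_imp_eq)
  then have "\<not> int p dvd int (p' ^ n)" by (simp only: int_dvd_int_iff not_False_eq_True)
  moreover have "c * of_int (int (p' ^ n)) = of_int m"
    using assms(2) by (simp add: c prime_gt_0_nat)
  ultimately show ?thesis unfolding pint_def by blast
qed

lemma fracs_of_int [simp]: "of_int m \<in> fracs p"
  by (rule fracsI[of _ m _ 0]) simp

lemma fracs_1 [simp]: "1 \<in> fracs p"
  using fracs_of_int[of 1 p] by simp

lemma fracs_minus: "c \<in> fracs p \<Longrightarrow> - c \<in> fracs p"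
proof (erule fracsE)
  fix m n assume "c = of_int m / of_nat (p ^ n)"
  then show ?thesis by (intro fracsI[of _ "- m" _ n]) simp
qed

lemma fracs_divide: "c \<in> fracs p \<Longrightarrow> c / of_nat (p ^ k) \<in> fracs p"
proof (erule fracsE)
  fix m n assume "c = of_int m / of_nat (p ^ n)"
  then show ?thesis by (intro fracsI[of _ m _ "n + k"]) (simp add: power_add)
qed

lemma pint_not_inverse:
  assumes "prime p" shows "1 / of_nat p \<notin> pint p"
proof
  assume "1 / of_nat p \<in> pint p"
  then obtain q m :: int where "\<not> int p dvd q" "1 / of_nat p * of_int q = (of_int m :: rat)"
    by (auto simp: pint_def)
  moreover from this have "(of_int q :: rat) = of_int (int p * m)"
    using assms by (simp add: field_simps prime_gt_0_nat)
  ultimately show False by (simp only: of_int_eq_iff) simp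
qed

text \<open>Z_(p) is p-adically separated: the numerator of \<open>x\<close> would be divisible by
  all powers of \<open>p\<close>, whereas \<open>p ^ k > k\<close> for its absolute value
  \<open>k\<close>.\<close>

lemma pint_divisible_eq_0:
  assumes p: "prime p" and x: "\<And>n. \<exists>y\<in>pint p. x = of_nat (p ^ n) * y"
  shows "x = 0"
proof -
  obtain y where "y \<in> pint p" "x = y" using x[of 0] by auto
  then obtain q m :: int where qm: "\<not> int p dvd q" "x * of_int q = of_int m"
    by (auto simp: pint_def)
  have dv: "int p ^ n dvd m" for n
  proof -
    obtain y where y: "y \<in> pint p" "x = of_nat (p ^ n) * y" using x by blast
    then obtain q' m' :: int where q': "\<not> int p dvd q'" "y * of_int q' = of_int m'"
      by (auto simp: pint_def)
    have "of_int (m * q') = (x * of_int q) * (of_int q' :: rat)" using qm(2) by simp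
    also have "\<dots> = of_nat (p ^ n) * (y * of_int q') * of_int q" by (simp add: y(2))
    also have "\<dots> = of_int (int p ^ n * (m' * q))" by (simp add: q'(2))
    finally have "m * q' = int p ^ n * (m' * q)" by (simp only: of_int_eq_iff)
    then have "int p ^ n dvd m * q'" by simp
    moreover have "coprime (int p ^ n) q'"
      using p q'(1) by (simp add: prime_imp_coprime)
    ultimately show ?thesis by (simp add: coprime_dvd_mult_left_iff)
  qed
  have "m = 0"
  proof (rule ccontr)
    assume "m \<noteq> 0"
    define k where "k = nat \<bar>m\<bar>"
    have "int p ^ k \<le> \<bar>m\<bar>"
      using dvd_imp_le_int[OF \<open>m \<noteq> 0\<close> dv[of k]] by simp
    then have "p ^ k \<le> k"
    proof -
      have "int (p ^ k) \<le> int k"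
        using \<open>int p ^ k \<le> \<bar>m\<bar>\<close> by (simp add: k_def)
      then show ?thesis by (simp only: of_nat_le_iff)
    qed
    moreover have "k < p ^ k"
      using power_gt_expt[of p k] prime_gt_1_nat[OF p] by simp
    ultimately show False by simp
  qed
  moreover have "q \<noteq> 0" using qm(1) by auto
  ultimately show ?thesis using qm(2) by simp
qed

section \<open>The group of a point\<close>

datatype gen = Mark node | Edge node | Base

instance gen :: countable by countable_datatype

text \<open>The lines \<open>Free a k\<close> make homomorphisms onto: \<open>Free a 0\<close> can cover the line of \<open>a\<close>, while
  \<open>Free a (Suc k)\<close> covers \<open>Free a k\<close>.\<close>

datatype basis = Nd node | Aux | Free gen nat

instance basis :: countable by countable_datatype

datatype tag = Mark_tag "nat list option" | Edge_tag "nat list option" | Base_tag | Glue_tag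

instance tag :: countable by countable_datatype

definition prm :: "tag \<Rightarrow> nat" where
  "prm l = enumerate {p. prime p} (to_nat l)"

lemma prime_prm [simp]: "prime (prm l)"
  using enumerate_in_set[OF primes_infinite] by (auto simp: prm_def)

lemma prm_eq_iff [simp]: "prm l = prm l' \<longleftrightarrow> l = l'"
proof -
  have "inj (enumerate {p :: nat. prime p})"
    using bij_enumerate[OF primes_infinite] by (simp add: bij_betw_def)
  then show ?thesis unfolding prm_def by (simp add: inj_eq)
qed

fun gtag :: "gen \<Rightarrow> tag" where
  "gtag (Mark i) = Mark_tag (lab i)"
| "gtag (Edge i) = Edge_tag (lab i)"
| "gtag Base = Base_tag"

lemma gtag_neq_Glue [simp]: "gtag a \<noteq> Glue_tag"
  by (cases a) auto

type_synonym vect = "basis \<Rightarrow>\<^sub>0 rat"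

text \<open>Since \<open>Root\<close> is its own parent, \<open>Edge Root\<close> contributes only
  the zero vector.\<close>

fun vec :: "gen \<Rightarrow> rat \<Rightarrow> vect" where
  "vec (Mark i) c = single (Nd i) c"
| "vec (Edge i) c = single (Nd i) c - single (Nd (par i)) c"
| "vec Base c = single Aux c"

definition glue :: "rat \<Rightarrow> vect" where
  "glue c = single (Nd Root) c - single Aux c"

lemma additive_vec: "additive (vec a)"
  by (cases a) (auto intro!: additive.intro simp: single_add)

lemma additive_glue: "additive glue"
  by (auto intro!: additive.intro simp: single_add glue_def)

lemma lookup_glue [simp]:
  "lookup (glue c) Aux = - c" "lookup (glue c) (Nd Root) = c"
  "i \<noteq> Root \<Longrightarrow> lookup (glue c) (Nd i) = 0"
  by (auto simp: glue_def lookup_minus lookup_single)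

abbreviation ell :: nat where "ell \<equiv> prm Glue_tag"

context closed_relation
begin

fun gvalid :: "(nat \<Rightarrow> nat) \<Rightarrow> gen \<Rightarrow> bool" where
  "gvalid z (Mark i) \<longleftrightarrow> valid z i"
| "gvalid z (Edge i) \<longleftrightarrow> valid z i"
| "gvalid z Base \<longleftrightarrow> True"

text \<open>Free lines exist for all \<open>a\<close>, valid or not: the group of \<open>y\<close>
  must cover the lines of the group of \<open>x\<close>, where other nodes are valid. The glue
  vector is divided by \<open>ell\<close> only once, and the two signs keep the generators closed
  under negation.\<close>

inductive_set gens :: "(nat \<Rightarrow> nat) \<Rightarrow> vect set" for z where
  vec: "gvalid z a \<Longrightarrow> c \<in> fracs (prm (gtag a)) \<Longrightarrow> vec a c \<in> gens z"
| free: "c \<in> fracs (prm (gtag a)) \<Longrightarrow> single (Free a k) c \<in> gens z"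
| glue: "c \<in> {1, -1} \<Longrightarrow> glue (c / of_nat ell) \<in> gens z"

text \<open>As the generators are closed under negation, this is the subgroup they generate; an
  existential over the countably many lists suits the later measurability proof.\<close>

definition Gp :: "(nat \<Rightarrow> nat) \<Rightarrow> vect set" where
  "Gp z = {sum_list ws | ws. set ws \<subseteq> gens z}"

lemma gens_subset: "v \<in> gens z \<Longrightarrow> v \<in> Gp z"
  unfolding Gp_def by (auto intro!: exI[of _ "[v]"])

lemma Gp_0: "0 \<in> Gp z"
  unfolding Gp_def by (auto intro!: exI[of _ "[]"])

lemma Gp_add: "u \<in> Gp z \<Longrightarrow> v \<in> Gp z \<Longrightarrow> u + v \<in> Gp z"
proof -
  assume "u \<in> Gp z" "v \<in> Gp z"
  then obtain us vs where "u = sum_list us" "set us \<subseteq> gens z" "v = sum_list vs" "set vs \<subseteq> gens z"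
    by (auto simp: Gp_def)
  then have "u + v = sum_list (us @ vs)" "set (us @ vs) \<subseteq> gens z" by auto
  then show ?thesis unfolding Gp_def by blast
qed

lemma Gp_induct [consumes 1, case_names zero add]:
  assumes "v \<in> Gp z" "P 0" "\<And>u w. u \<in> gens z \<Longrightarrow> w \<in> Gp z \<Longrightarrow> P w \<Longrightarrow> P (u + w)"
  shows "P v"
proof -
  obtain ws where ws: "v = sum_list ws" "set ws \<subseteq> gens z" using assms(1) by (auto simp: Gp_def)
  have "P (sum_list ws) \<and> sum_list ws \<in> Gp z"
    using ws(2) by (induction ws) (auto intro: assms Gp_add Gp_0 gens_subset)
  then show ?thesis using ws(1) by simp
qed

lemma gens_uminus: "v \<in> gens z \<Longrightarrow> - v \<in> gens z"
proof (induction rule: gens.induct)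
  case (vec a c)
  then show ?case
    using gens.vec[of z a "- c"] by (simp add: fracs_minus additive.minus[OF additive_vec])
next
  case (free c a k)
  then show ?case
    using gens.free[of "- c" a k z] by (simp add: fracs_minus single_uminus)
next
  case (glue c)
  then show ?case
    using gens.glue[of "- c" z] by (auto simp: additive.minus[OF additive_glue])
qed

lemma add_subgroup_Gp: "add_subgroup (Gp z)"
  unfolding add_subgroup_def
proof (intro conjI ballI Gp_0 Gp_add)
  fix v assume "v \<in> Gp z"
  then show "- v \<in> Gp z"
  proof (induction rule: Gp_induct)
    case (add u w)
    have "- u \<in> Gp z" using add(1) by (intro gens_subset gens_uminus)
    then have "- u + - w \<in> Gp z" using add(3) by (rule Gp_add)
    then show ?case by simp
  qed (simp add: Gp_0)
qed

lemma Gp_nsm: "v \<in> Gp z \<Longrightarrow> nsm n v \<in> Gp z"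
  by (induction n) (auto simp: nsm_Suc intro: Gp_0 Gp_add)

lemma infinite_Gp: "infinite (Gp z)"
proof
  assume "finite (Gp z)"
  moreover have "range (\<lambda>m::int. vec Base (of_int m)) \<subseteq> Gp z"
    by (auto simp del: vec.simps intro!: gens_subset gens.vec)
  ultimately have "finite (range (\<lambda>m::int. vec Base (of_int m)))"
    by (rule rev_finite_subset)
  moreover have "inj (\<lambda>m::int. vec Base (of_int m))"
  proof (rule injI)
    fix m n :: int assume "vec Base (of_int m) = vec Base (of_int n)"
    then have "lookup (vec Base (of_int m)) Aux = lookup (vec Base (of_int n)) Aux" by (rule arg_cong)
    then show "m = n" by simp
  qed
  ultimately show False
    using finite_imageD infinite_UNIV_int by blast
qed

lemma pint_Gp:
  assumes "additive \<theta>" "prime p" "\<And>v. v \<in> gens z \<Longrightarrow> \<theta> v \<in> pint p" "v \<in> Gp z"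
  shows "\<theta> v \<in> pint p"
  using assms(4)
  by (induction rule: Gp_induct)
    (use assms in \<open>auto simp: additive.zero[OF assms(1)] additive.add[OF assms(1)] intro: pint_add\<close>)

section \<open>Infinitely divisible elements and the functionals vanishing on them\<close>

definition pdiv :: "tag \<Rightarrow> vect set \<Rightarrow> vect set" where
  "pdiv l H = {v. \<forall>n. \<exists>w\<in>H. v = nsm (prm l ^ n) w}"

lemma pdiv_line:
  assumes "additive f" "\<And>c. c \<in> fracs (prm l) \<Longrightarrow> f c \<in> Gp z" "c \<in> fracs (prm l)"
  shows "f c \<in> pdiv l (Gp z)"
  unfolding pdiv_def
proof safe
  fix n
  have "f c = nsm (prm l ^ n) (f (c / of_nat (prm l ^ n)))"
    by (simp add: nsm_additive[OF assms(1)] prime_gt_0_nat)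
  then show "\<exists>w\<in>Gp z. f c = nsm (prm l ^ n) w"
    using assms(2) fracs_divide[OF assms(3)] by blast
qed

lemma vec_in_pdiv: "gvalid z a \<Longrightarrow> c \<in> fracs (prm (gtag a)) \<Longrightarrow> vec a c \<in> pdiv (gtag a) (Gp z)"
  by (rule pdiv_line[OF additive_vec]) (auto intro: gens_subset gens.vec)

lemma free_in_pdiv: "c \<in> fracs (prm (gtag a)) \<Longrightarrow> single (Free a k) c \<in> pdiv (gtag a) (Gp z)"
  by (rule pdiv_line[OF additive_single]) (auto intro: gens_subset gens.free)

text \<open>With p the prime of \<open>l\<close>, \<theta> is p-integral on the whole group: it
  kills the generators with tag \<open>l\<close> and the free ones, and the coefficients of all
  others have denominators prime to p. The value at a p-divisible element is then divisible by all
  powers of p in Z_(p), hence zero.\<close>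

lemma functional_vanishes:
  assumes \<theta>: "additive \<theta>"
    and int: "\<And>a c. \<exists>m::int. \<theta> (vec a c) = of_int m * c" "\<And>c. \<exists>m::int. \<theta> (glue c) = of_int m * c"
    and 0: "\<And>a k c. \<theta> (single (Free a k) c) = 0" "\<And>a c. gtag a = l \<Longrightarrow> \<theta> (vec a c) = 0"
    and l: "l \<noteq> Glue_tag" and v: "v \<in> pdiv l (Gp z)"
  shows "\<theta> v = 0"
proof (rule pint_divisible_eq_0[of "prm l"])
  have "\<theta> u \<in> pint (prm l)" if "u \<in> gens z" for u
    using that
  proof cases
    case (vec a c)
    obtain m :: int where m: "\<theta> (vec a c) = of_int m * c" using int(1) by blast
    show ?thesis
    proof (cases "gtag a = l")
      case False
      then have "c \<in> pint (prm l)"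
        using fracs_in_pint[of "prm l" "prm (gtag a)" c] vec(3) by auto
      then show ?thesis unfolding vec(1) m by (rule pint_mult_int)
    qed (simp add: vec(1) 0)
  next
    case (free c a k)
    then show ?thesis by (simp add: 0)
  next
    case (glue c)
    obtain m :: int where m: "\<theta> (glue (c / of_nat ell)) = of_int m * (c / of_nat ell)" using int(2) by blast
    have "c / of_nat ell \<in> fracs ell"
      using glue(2) fracs_divide[of 1 ell 1] fracs_divide[of "-1" ell 1] fracs_minus[of 1 ell] by auto
    then have "c / of_nat ell \<in> pint (prm l)"
      using fracs_in_pint[of "prm l" ell] l by auto
    then show ?thesis unfolding glue(1) m by (rule pint_mult_int)
  qed
  then have "\<theta> w \<in> pint (prm l)" if "w \<in> Gp z" for w
    using pint_Gp[OF \<theta> prime_prm] that by blast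
  then show "\<exists>y\<in>pint (prm l). \<theta> v = of_nat (prm l ^ n) * y" for n
    using v additive_nsm[OF \<theta>] by (fastforce simp: pdiv_def)
qed simp

lemma coordinate_vanishes:
  assumes "v \<in> pdiv l (Gp z)" "l \<noteq> Glue_tag"
    and "\<And>a c. gtag a = l \<Longrightarrow> lookup (vec a c) k = 0" "\<And>a j. k \<noteq> Free a j"
  shows "lookup v k = 0"
proof (rule functional_vanishes[OF additive_lookup _ _ _ assms(3) assms(2,1)])
  show "\<exists>m::int. lookup (vec a c) k = of_int m * c" for a c
  proof (cases a)
    case (Edge i)
    have "lookup (vec a c) k = of_int ((if k = Nd i then 1 else 0) - (if k = Nd (par i) then 1 else 0)) * c"
      by (auto simp: Edge lookup_minus lookup_single when_def)
    then show ?thesis by blast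
  qed (auto simp: lookup_single when_def intro: exI[of _ "0::int"] exI[of _ "1::int"])
  show "\<exists>m::int. lookup (glue c) k = of_int m * c" for c
  proof -
    have "lookup (glue c) k = of_int ((if k = Nd Root then 1 else 0) - (if k = Aux then 1 else 0)) * c"
      by (auto simp: glue_def lookup_minus lookup_single when_def)
    then show ?thesis by blast
  qed
  show "lookup (single (Free a j) c) k = 0" for a j c
    using assms(4)[of a j] by (auto simp: lookup_single when_def)
qed

lemma pdiv_mark:
  assumes "v \<in> pdiv (Mark_tag \<mu>) (Gp z)" "lookup v (Nd i) \<noteq> 0"
  shows "lab i = \<mu>"
proof (rule ccontr)
  assume ne: "lab i \<noteq> \<mu>"
  have "lookup (vec a c) (Nd i) = 0" if "gtag a = Mark_tag \<mu>" for a c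
    using that ne by (cases a) (auto simp: lookup_single when_def)
  then show False using coordinate_vanishes[OF assms(1), of "Nd i"] assms(2) by auto
qed

lemma pdiv_Aux:
  assumes "v \<in> pdiv l (Gp z)" "l \<noteq> Glue_tag" "l \<noteq> Base_tag"
  shows "lookup v Aux = 0"
proof (rule coordinate_vanishes[OF assms(1,2)])
  show "lookup (vec a c) Aux = 0" if "gtag a = l" for a c
    using that assms(3) by (cases a) (auto simp: lookup_single when_def lookup_minus)
qed auto

lemma pdiv_Base:
  assumes "v \<in> pdiv Base_tag (Gp z)"
  shows "lookup v (Nd i) = 0"
proof (rule coordinate_vanishes[OF assms])
  show "lookup (vec a c) (Nd i) = 0" if "gtag a = Base_tag" for a c
    using that by (cases a) (auto simp: lookup_single when_def)
qed auto

text \<open>This functional kills every edge difference with label \<open>\<mu>\<close>, provided that \<open>j\<close> itself does not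
  have label \<open>\<mu>\<close>.\<close>

definition fold_children :: "nat list option \<Rightarrow> node \<Rightarrow> vect \<Rightarrow> rat" where
  "fold_children \<mu> j = ext (\<lambda>k c. case k of
     Nd i \<Rightarrow> if i = j \<or> par i = j \<and> lab i = \<mu> then c else 0 | _ \<Rightarrow> 0)"

lemma additive_fold_children: "additive (fold_children \<mu> j)"
  unfolding fold_children_def by (rule additive_ext) (auto intro!: additive.intro split: basis.split)

lemma fold_children_single:
  "fold_children \<mu> j (single (Nd i) c) = (if i = j \<or> par i = j \<and> lab i = \<mu> then c else 0)"
  "fold_children \<mu> j (single Aux c) = 0"
  "fold_children \<mu> j (single (Free a k) c) = 0"
  by (simp_all add: fold_children_def ext_single)

text \<open>An edge difference with label \<mu> has the same weight at the node and at its parent: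
  both count exactly if the parent is \<open>j\<close>, because the parent and \<open>j\<close> have
  labels other than \<mu>.\<close>

lemma pdiv_edge:
  assumes v: "v \<in> pdiv (Edge_tag \<mu>) (Gp z)" and j: "lab j \<noteq> \<mu>" and \<mu>: "\<mu> \<noteq> None"
  shows "fold_children \<mu> j v = 0"
proof (rule functional_vanishes[OF additive_fold_children _ _ _ _ _ v])
  have vec: "fold_children \<mu> j (vec (Edge i) c) = fold_children \<mu> j (single (Nd i) c) - fold_children \<mu> j (single (Nd (par i)) c)" for i c
    by (simp add: additive.diff[OF additive_fold_children])
  show "\<exists>m::int. fold_children \<mu> j (vec a c) = of_int m * c" for a c
  proof (cases a)
    case (Edge i)
    define b where "b i = (if i = j \<or> par i = j \<and> lab i = \<mu> then 1 else 0 :: int)" for i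
    have "fold_children \<mu> j (vec a c) = of_int (b i - b (par i)) * c"
      unfolding Edge vec by (auto simp: fold_children_single b_def)
    then show ?thesis by blast
  qed (auto simp: fold_children_single intro: exI[of _ "0::int"] exI[of _ "1::int"])
  show "\<exists>m::int. fold_children \<mu> j (glue c) = of_int m * c" for c
    by (auto simp: glue_def additive.diff[OF additive_fold_children] fold_children_single
        intro: exI[of _ "0::int"] exI[of _ "1::int"])
  show "fold_children \<mu> j (vec a c) = 0" if "gtag a = Edge_tag \<mu>" for a c
  proof (cases a)
    case (Edge i)
    then have "lab i = \<mu>" using that by simp
    then have "lab (par i) \<noteq> \<mu>" "i \<noteq> j" using lab_par_neq[of i] \<mu> j by auto
    then show ?thesis using \<open>lab i = \<mu>\<close> unfolding Edge vec by (simp add: fold_children_single)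
  qed (use that in auto)
qed (auto simp: fold_children_single)

text \<open>Generators involve only valid nodes and their parents, and validity passes to
  parents.\<close>

lemma lookup_valid:
  assumes "v \<in> Gp z" "lookup v (Nd i) \<noteq> 0" shows "valid z i"
  using assms
proof (induction arbitrary: i rule: Gp_induct)
  case (add u w)
  have "valid z i" if "lookup u (Nd i) \<noteq> 0"
    using add(1)
  proof cases
    case (vec a c)
    then show ?thesis using that valid_par
      by (cases a) (auto simp: lookup_single when_def lookup_minus split: if_splits)
  next
    case (glue c)
    then show ?thesis using that by (cases "i = Root") auto
  qed (use that in \<open>auto simp: lookup_single when_def\<close>)
  then show ?case using add(3,4) by (cases "lookup u (Nd i) = 0") (auto simp: lookup_add)
qed auto

section \<open>From a witness to an epimorphism\<close>

lemma epimorphism_of_witness: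
  assumes C: "C x \<gamma> y"
  obtains \<psi> where "additive \<psi>" "\<psi> ` Gp y = Gp x"
proof -
  \<comment> \<open>Nodes are prefixed by the witness, while the free lines shift down by one and
    end on the line of \<open>a\<close>. The value 0 is the default where that line is absent from
    the group of \<open>x\<close>.\<close>
  define f where "f k c = (case k of
      Nd i \<Rightarrow> single (Nd (push \<gamma> y i)) c
    | Aux \<Rightarrow> single Aux c
    | Free a 0 \<Rightarrow> if gvalid x a then vec a c else 0
    | Free a (Suc n) \<Rightarrow> single (Free a n) c)" for k and c :: rat
  define \<psi> where "\<psi> = ext f"
  have f: "additive (f k)" for k
    using additive_vec unfolding f_def
    by (cases k) (auto intro!: additive.intro simp: single_add additive.add[OF additive_vec] split: nat.split)
  have add: "additive \<psi>"
    unfolding \<psi>_def by (rule additive_ext) (rule f)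
  have single: "\<psi> (single k c) = f k c" for k c
    unfolding \<psi>_def by (rule ext_single) (rule additive.zero[OF f])
  \<comment> \<open>\<open>push\<close> fixes \<open>Root\<close>, so the glue element, which no
    free line covers, is its own preimage.\<close>
  have glue: "\<psi> (glue c) = glue c" for c
    by (simp add: glue_def additive.diff[OF add] single f_def)
  have gens: "\<psi> v \<in> Gp x" if "v \<in> gens y" for v
    using that
  proof cases
    case (vec a c)
    show ?thesis
    proof (cases a)
      case (Mark i)
      then have "\<psi> v = vec (Mark (push \<gamma> y i)) c" by (simp add: vec single f_def)
      also have "\<dots> \<in> gens x" using vec Mark valid_push[OF C] by (intro gens.vec) auto
      finally show ?thesis by (rule gens_subset)
    next
      case (Edge i)
      then have "\<psi> v = vec (Edge (push \<gamma> y i)) c"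
        by (simp add: vec additive.diff[OF add] single f_def par_push)
      also have "\<dots> \<in> gens x" using vec Edge valid_push[OF C] by (intro gens.vec) auto
      finally show ?thesis by (rule gens_subset)
    next
      case Base
      then have "\<psi> v = vec Base c" by (simp add: vec single f_def)
      also have "\<dots> \<in> gens x" using vec Base by (intro gens.vec) auto
      finally show ?thesis by (rule gens_subset)
    qed
  next
    case (free c a k)
    show ?thesis
    proof (cases k)
      case 0
      then show ?thesis using free(2) by (auto simp: free(1) single f_def intro: gens_subset gens.vec Gp_0)
    next
      case (Suc n)
      then show ?thesis using free(2) by (auto simp: free(1) single f_def intro: gens_subset gens.free)
    qed
  next
    case (glue c)
    then show ?thesis using gens.glue[of c x] by (auto simp: \<open>\<And>c. \<psi> (glue c) = glue c\<close> intro: gens_subset)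
  qed
  have onto: "v \<in> \<psi> ` gens y" if "v \<in> gens x" for v
    using that
  proof cases
    case (vec a c)
    then have "v = \<psi> (single (Free a 0) c)" by (simp add: single f_def)
    then show ?thesis using gens.free[OF vec(3)] by blast
  next
    case (free c a k)
    then have "v = \<psi> (single (Free a (Suc k)) c)" by (simp add: single f_def)
    then show ?thesis using gens.free[OF free(2)] by blast
  next
    case (glue c)
    then show ?thesis using gens.glue[OF glue(2)] \<open>\<And>c. \<psi> (glue c) = glue c\<close> by (metis image_eqI)
  qed
  have "\<psi> v \<in> Gp x" if "v \<in> Gp y" for v
    using that by (induction rule: Gp_induct)
      (auto simp: additive.zero[OF add] additive.add[OF add] intro: Gp_0 Gp_add gens)
  moreover have "v \<in> \<psi> ` Gp y" if "v \<in> Gp x" for v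
    using that
  proof (induction rule: Gp_induct)
    case zero
    show ?case using Gp_0 additive.zero[OF add] by (metis image_eqI)
  next
    case (add u w)
    then obtain u' w' where "u = \<psi> u'" "u' \<in> gens y" "w = \<psi> w'" "w' \<in> Gp y"
      using onto by blast
    then have "u + w = \<psi> (u' + w')" "u' + w' \<in> Gp y"
      using \<open>additive \<psi>\<close> by (auto simp: additive.add intro: Gp_add gens_subset)
    then show ?case by blast
  qed
  ultimately have "\<psi> ` Gp y = Gp x" by blast
  with add show thesis by (rule that)
qed

section \<open>From an epimorphism back to a chain\<close>

lemma epimorphism_imp_chain:
  assumes add: "\<And>a b. a \<in> Gp y \<Longrightarrow> b \<in> Gp y \<Longrightarrow> \<psi> (a + b) = \<psi> a + \<psi> b"
    and onto: "\<psi> ` Gp y = Gp x"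
  shows "R\<^sup>*\<^sup>* x y"
proof -
  have mem: "\<psi> v \<in> Gp x" if "v \<in> Gp y" for v using onto that by auto
  have \<psi>0: "\<psi> 0 = 0" using add[of 0 0] Gp_0 by simp
  have minus: "- v \<in> Gp y" if "v \<in> Gp y" for v
    using that add_subgroup_Gp by (auto simp: add_subgroup_def)
  have \<psi>_minus: "\<psi> (- v) = - \<psi> v" if "v \<in> Gp y" for v
    using add[OF that minus[OF that]] \<psi>0 by (simp add: eq_neg_iff_add_eq_0 add.commute)
  have \<psi>_diff: "\<psi> (u - v) = \<psi> u - \<psi> v" if "u \<in> Gp y" "v \<in> Gp y" for u v
    using add[of u "- v"] that minus by (simp add: \<psi>_minus)
  have nsm: "\<psi> (nsm n v) = nsm n (\<psi> v)" if "v \<in> Gp y" for n v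
    by (induction n) (simp_all add: \<psi>0 nsm_Suc add that Gp_nsm)
  have pdiv: "\<psi> v \<in> pdiv l (Gp x)" if "v \<in> pdiv l (Gp y)" for v l
    unfolding pdiv_def
  proof safe
    fix n
    obtain w where "w \<in> Gp y" "v = nsm (prm l ^ n) w" using \<open>v \<in> pdiv l (Gp y)\<close> by (auto simp: pdiv_def)
    then show "\<exists>w\<in>Gp x. \<psi> v = nsm (prm l ^ n) w" using nsm mem by auto
  qed
  have node: "single (Nd i) c \<in> Gp y" "\<psi> (single (Nd i) c) \<in> pdiv (Mark_tag (lab i)) (Gp x)"
    if "valid y i" "c \<in> fracs (prm (Mark_tag (lab i)))" for i c
    using gens.vec[of y "Mark i" c] vec_in_pdiv[of y "Mark i" c] that by (auto intro: gens_subset pdiv)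
  have aux: "single Aux c \<in> Gp y" "\<psi> (single Aux c) \<in> pdiv Base_tag (Gp x)"
    if "c \<in> fracs (prm Base_tag)" for c
    using gens.vec[of y Base c] vec_in_pdiv[of y Base c] that by (auto intro: gens_subset pdiv)

  (* The glue element has coefficients 1/ell and -1/ell at Root and Aux, so the sum below is
     ell-integral everywhere although the coefficient at Root is not. *)
  have sum_int: "lookup v (Nd Root) + lookup v Aux \<in> pint ell" if "v \<in> Gp x" for v
  proof (rule pint_Gp[OF _ prime_prm _ that])
    show "additive (\<lambda>v :: vect. lookup v (Nd Root) + lookup v Aux)"
      by (auto intro!: additive.intro simp: lookup_add)
    fix u assume "u \<in> gens x"
    then show "lookup u (Nd Root) + lookup u Aux \<in> pint ell"
    proof cases
      case (vec a c)
      then have c: "c \<in> pint ell" using fracs_in_pint[of ell "prm (gtag a)" c] by (cases a) auto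
      then have "- c \<in> pint ell" using pint_mult_int[of c ell "-1"] by simp
      with c show ?thesis
        by (cases a) (auto simp: vec lookup_single when_def lookup_minus)
    qed (auto simp: lookup_single)
  qed
  \<comment> \<open>A divisible element has coefficient 0 at \<open>Root\<close> or at
    \<open>Aux\<close>, according to its tag. In the latter case the sum in \<open>sum_int\<close>
    is the coefficient at \<open>Root\<close>.\<close>
  have root_int: "lookup v (Nd Root) \<in> pint ell" if "v \<in> pdiv l (Gp x)" "l \<noteq> Glue_tag" for v l
  proof (cases "l = Base_tag")
    case True
    then show ?thesis using pdiv_Base that by simp
  next
    case False
    \<comment> \<open>The exponent 0 shows that \<open>v\<close> itself belongs to the
      group.\<close>
    have "\<exists>w\<in>Gp x. v = nsm (prm l ^ 0) w" using that(1) unfolding pdiv_def by blast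
    then obtain w where "w \<in> Gp x" "v = nsm (prm l ^ 0) w" by blast
    then have "v \<in> Gp x" using Gp_nsm[of w x "prm l ^ 0"] by simp
    then show ?thesis using sum_int[of v] pdiv_Aux[OF that False] by simp
  qed

  \<comment> \<open>Otherwise the coefficient at \<open>Root\<close> would be
    \<open>ell\<close>-integral on the whole image, whereas it is \<open>1 / ell\<close> at the glue
    element.\<close>
  have root: "lookup (\<psi> (single (Nd Root) 1)) (Nd Root) \<noteq> 0"
  proof
    assume 0: "lookup (\<psi> (single (Nd Root) 1)) (Nd Root) = 0"
    have r1: "single (Nd Root) 1 \<in> Gp y" using node(1)[of Root 1] by simp
    have glue0: "lookup (\<psi> (glue (c / of_nat ell))) (Nd Root) = 0" if "c \<in> {1, -1}" for c
    proof -
      have g: "glue (c / of_nat ell) \<in> Gp y" using that by (intro gens_subset gens.glue)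
      have c: "c \<in> fracs p" for p using that fracs_1 fracs_minus[OF fracs_1] by auto
      have rc: "single (Nd Root) c \<in> Gp y" using node(1)[of Root c] c by simp
      have "single (Nd Root) c = (if c = 1 then single (Nd Root) 1 else - single (Nd Root) 1)"
        using that by (auto simp: single_uminus)
      then have root0: "lookup (\<psi> (single (Nd Root) c)) (Nd Root) = 0"
        using 0 r1 by (simp add: \<psi>_minus)
      \<comment> \<open>Multiplication by \<open>ell\<close> splits the glue element into a multiple
        of \<open>Root\<close>, whose image has coefficient 0 by assumption, and one of
        \<open>Aux\<close>, whose image has coefficient 0 by \<open>pdiv_Base\<close>.\<close>
      have "nsm ell (glue (c / of_nat ell)) = glue c"
        by (simp add: nsm_additive[OF additive_glue] prime_gt_0_nat)
      then have "nsm ell (\<psi> (glue (c / of_nat ell))) = \<psi> (single (Nd Root) c) - \<psi> (single Aux c)"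
        using \<psi>_diff[OF rc aux(1)[OF c]] nsm[OF g, of ell] by (simp add: glue_def)
      then have "of_nat ell * lookup (\<psi> (glue (c / of_nat ell))) (Nd Root) = 0"
        using root0 pdiv_Base[OF aux(2)[OF c]] additive_nsm[OF additive_lookup] by (metis diff_0_right lookup_minus)
      then show ?thesis using prime_gt_0_nat[OF prime_prm, of Glue_tag] by auto
    qed
    have img: "lookup (\<psi> v) (Nd Root) \<in> pint ell" if "v \<in> Gp y" for v
      using that
    proof (induction rule: Gp_induct)
      case (add u w)
      have u: "u \<in> Gp y" using add(1) by (rule gens_subset)
      have "lookup (\<psi> u) (Nd Root) \<in> pint ell"
        using add(1)
      proof cases
        case (vec a c)
        then show ?thesis using root_int[OF pdiv[OF vec_in_pdiv]] by simp
      next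
        case (free c a k)
        then show ?thesis using root_int[OF pdiv[OF free_in_pdiv]] by simp
      next
        case (glue c)
        then show ?thesis using glue0 by simp
      qed
      then show ?case
        using add(2,3) u by (simp add: assms(1) lookup_add pint_add)
    qed (simp add: \<psi>0)
    have "glue (1 / of_nat ell) \<in> \<psi> ` Gp y"
      unfolding onto by (intro gens_subset gens.glue) simp
    then obtain v where "v \<in> Gp y" "\<psi> v = glue (1 / of_nat ell)" by auto
    with img[of v] pint_not_inverse[OF prime_prm, of Glue_tag] show False by simp
  qed

  define a where "a n = \<psi> (single (Nd (trunk y n)) 1)" for n
  have a: "a n \<in> pdiv (Mark_tag (lab (trunk y n))) (Gp x)" "a n \<in> Gp x" for n
    using node[of "trunk y n" 1] mem by (auto simp: a_def)
  have lab_a: "lab i = lab (trunk y n)" if "lookup (a n) (Nd i) \<noteq> 0" for i n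
    using pdiv_mark[OF a(1) that] .
  \<comment> \<open>The difference \<open>a (Suc n) - a n\<close> is the image of an edge vector, so
    the coefficient of \<open>a n\<close> at \<open>j\<close> equals the sum of those of
    \<open>a (Suc n)\<close> at the children of \<open>j\<close>. Labels decide which terms of
    \<open>fold_children\<close> survive on each side.\<close>
  have child: "\<exists>i. par i = j \<and> lookup (a (Suc n)) (Nd i) \<noteq> 0" if j: "lookup (a n) (Nd j) \<noteq> 0" for n j
  proof (rule ccontr)
    assume no: "\<not> ?thesis"
    define \<mu> where "\<mu> = lab (trunk y (Suc n))"
    have lab_j: "lab j \<noteq> \<mu>" using lab_a[OF j] by (simp add: \<mu>_def del: trunk.simps)
    have "vec (Edge (trunk y (Suc n))) 1 \<in> pdiv (Edge_tag \<mu>) (Gp y)"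
      using vec_in_pdiv[of y "Edge (trunk y (Suc n))" 1] by (simp add: \<mu>_def del: trunk.simps)
    moreover have "\<psi> (vec (Edge (trunk y (Suc n))) 1) = a (Suc n) - a n"
      using \<psi>_diff[OF node(1)[of "trunk y (Suc n)" 1] node(1)[of "trunk y n" 1]]
      by (simp add: a_def del: trunk.simps)
    ultimately have "a (Suc n) - a n \<in> pdiv (Edge_tag \<mu>) (Gp x)"
      using pdiv by metis
    then have "fold_children \<mu> j (a (Suc n) - a n) = 0"
      by (rule pdiv_edge[OF _ lab_j]) (simp add: \<mu>_def)
    then have "fold_children \<mu> j (a (Suc n)) = fold_children \<mu> j (a n)"
      by (simp add: additive.diff[OF additive_fold_children])
    moreover have "fold_children \<mu> j (a (Suc n)) = 0"
      unfolding fold_children_def ext_def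
    proof (rule sum.neutral, safe)
      fix k
      show "(case k of Nd i \<Rightarrow> if i = j \<or> par i = j \<and> lab i = \<mu> then lookup (a (Suc n)) k else 0 | _ \<Rightarrow> 0) = 0"
        using no lab_j lab_a[of "Suc n" j] by (auto simp: \<mu>_def split: basis.split simp del: trunk.simps)
    qed
    moreover have "fold_children \<mu> j (a n) = lookup (a n) (Nd j)"
    proof -
      have "fold_children \<mu> j (a n) = (\<Sum>k\<in>{Nd j}. lookup (a n) k)"
        unfolding fold_children_def ext_def
      proof (rule sum.mono_neutral_cong_right)
        show "{Nd j} \<subseteq> keys (a n)" using j by (simp add: in_keys_iff)
        show "\<forall>k\<in>keys (a n) - {Nd j}. (case k of Nd i \<Rightarrow> if i = j \<or> par i = j \<and> lab i = \<mu> then lookup (a n) k else 0 | _ \<Rightarrow> 0) = 0"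
          using lab_a[of n] by (auto simp: \<mu>_def in_keys_iff split: basis.split simp del: trunk.simps)
      qed auto
      then show ?thesis by simp
    qed
    ultimately show False using j by simp
  qed
  obtain i where i: "\<And>n. lookup (a n) (Nd (i n)) \<noteq> 0" "\<And>n. par (i (Suc n)) = i n"
  proof -
    have "\<exists>i. \<forall>n. lookup (a n) (Nd (i n)) \<noteq> 0 \<and> par (i (Suc n)) = i n"
    proof (rule dependent_nat_choice)
      show "\<exists>i. lookup (a 0) (Nd i) \<noteq> 0" using root by (auto simp: a_def)
      show "\<exists>i'. lookup (a (Suc n)) (Nd i') \<noteq> 0 \<and> par i' = i" if "lookup (a n) (Nd i) \<noteq> 0" for i n
        using child[OF that] by blast
    qed
    then show thesis using that by blast
  qed
  show ?thesis
    by (rule branch_imp_chain) (rule lookup_valid[OF a(2) i(1)] i(2) lab_a[OF i(1)])+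
qed

section \<open>Borel dependence of the group on the code\<close>

lemma measurable_Gp:
  assumes [measurable]: "\<And>n. (\<lambda>t. \<phi> t n) \<in> measurable M (count_space UNIV)"
  shows "{t \<in> space M. v \<in> Gp (\<phi> t)} \<in> sets M"
proof -
  have pre [measurable]: "Measurable.pred M (\<lambda>t. pre n (\<phi> t) = u)" for n u
  proof -
    have "pre n (\<phi> t) = u \<longleftrightarrow> length u = n \<and> (\<forall>i<n. \<phi> t i = u ! i)" for t
      by (auto simp: list_eq_iff_nth_eq)
    then show ?thesis by simp
  qed
  have valid [measurable]: "Measurable.pred M (\<lambda>t. valid (\<phi> t) i)" for i
  proof (cases i)
    case (Node v L)
    \<comment> \<open>Only a prefix of fixed length matters, and it has countably many possible
      values \<open>u\<close>.\<close>
    have "valid (\<phi> t) i \<longleftrightarrow> (\<exists>u. pre (length v) (\<phi> t) = u \<and> chain u L v)" for t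
      by (simp add: Node)
    then show ?thesis by (simp only:) measurable
  qed simp
  have gvalid [measurable]: "Measurable.pred M (\<lambda>t. gvalid (\<phi> t) a)" for a
    by (cases a) simp_all
  have gens [measurable]: "Measurable.pred M (\<lambda>t. w \<in> gens (\<phi> t))" for w
    unfolding gens.simps by measurable
  have "Measurable.pred M (\<lambda>t. \<exists>ws. v = sum_list ws \<and> (\<forall>w. w \<in> set ws \<longrightarrow> w \<in> gens (\<phi> t)))"
    by measurable
  then show ?thesis by (simp add: Gp_def pred_def subset_iff)
qed

end

section \<open>The reduction\<close>

lemma borel_reduces_epi_rel:
  fixes X :: "'a::polish_space set"
  assumes "analytic P" and qo: "quasi_order_on X P"
  shows "borel_reduces X P group_codes epi_rel"
proof (cases "X = {}")
  case True
  then show ?thesis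
    by (auto simp: borel_reduces_def borel_map_def measurable_def space_restrict_space)
next
  case False
  have P: "P \<subseteq> X \<times> X" "\<And>x. x \<in> X \<Longrightarrow> (x, x) \<in> P" "trans P"
    using qo by (auto simp: quasi_order_on_def refl_on_def)
  then obtain f :: "(nat \<Rightarrow> nat) \<Rightarrow> 'a \<times> 'a" where f: "continuous_on UNIV f" "range f = P"
    using \<open>analytic P\<close> False by (auto simp: analytic_def)
  obtain D :: "'a set" where D: "countable D" "D \<noteq> {}" "\<And>U. open U \<Longrightarrow> U \<noteq> {} \<Longrightarrow> \<exists>y\<in>D. y \<in> U"
    using countable_dense_exists by blast
  define d where "d = from_nat_into D"
  \<comment> \<open>A point is coded by indices of a fast converging sequence from the dense set.
    Each point has many codes, of which \<phi> picks the one with least entries; a parameter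
    \<gamma> of a pair in \<open>P\<close> serves as witness.\<close>
  define cod where "cod z x \<longleftrightarrow> (\<forall>n. dist x (d (z n)) \<le> (1 / 2) ^ n)" for z x
  define C where "C z \<gamma> w \<longleftrightarrow> cod z (fst (f \<gamma>)) \<and> cod w (snd (f \<gamma>))" for z \<gamma> w
  define \<phi> where "\<phi> x n = (LEAST m. dist x (d m) \<le> (1 / 2) ^ n)" for x n

  have cod_limit: "cod z (g \<gamma>)"
    if g: "continuous_on UNIV g" and near: "\<And>n. \<exists>z' \<gamma>'. cod z' (g \<gamma>') \<and> pre n z = pre n z' \<and> pre n \<gamma> = pre n \<gamma>'"
    for z \<gamma> and g :: "(nat \<Rightarrow> nat) \<Rightarrow> 'a"
    unfolding cod_def
  proof
    fix k
    let ?T = "{\<gamma>. dist (g \<gamma>) (d (z k)) \<le> (1 / 2) ^ k}"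
    have "closed ?T" by (intro closed_Collect_le continuous_intros g)
    moreover have "\<exists>t\<in>?T. pre n t = pre n \<gamma>" for n
    proof -
      \<comment> \<open>The length exceeds \<open>k\<close> so that the prefix also fixes the entry
        \<open>z k\<close>.\<close>
      obtain z' \<gamma>' where *: "cod z' (g \<gamma>')" "pre (max n (Suc k)) z = pre (max n (Suc k)) z'"
        "pre (max n (Suc k)) \<gamma> = pre (max n (Suc k)) \<gamma>'"
        using near by blast
      have "z k = z' k" using *(2) by (simp add: pre_eq_iff)
      moreover have "pre n \<gamma> = pre n \<gamma>'" using *(3) by (rule pre_mono) simp
      ultimately show ?thesis using *(1) by (auto simp: cod_def intro!: bexI[of _ \<gamma>'])
    qed
    ultimately have "\<gamma> \<in> ?T" by (rule pre_limit_in_closed)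
    then show "dist (g \<gamma>) (d (z k)) \<le> (1 / 2) ^ k" by simp
  qed
  interpret closed_relation C
  proof
    fix z \<gamma> w
    assume *: "\<exists>z' \<gamma>' w'. C z' \<gamma>' w' \<and> pre n z = pre n z' \<and> pre n \<gamma> = pre n \<gamma>' \<and> pre n w = pre n w'" for n
    have "cod z (fst (f \<gamma>))"
    proof (rule cod_limit[where g = "\<lambda>\<gamma>. fst (f \<gamma>)"])
      show "\<exists>z' \<gamma>'. cod z' (fst (f \<gamma>')) \<and> pre n z = pre n z' \<and> pre n \<gamma> = pre n \<gamma>'" for n
        using *[of n] unfolding C_def by blast
    qed (intro continuous_intros f)
    moreover have "cod w (snd (f \<gamma>))"
    proof (rule cod_limit[where g = "\<lambda>\<gamma>. snd (f \<gamma>)"])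
      show "\<exists>w' \<gamma>'. cod w' (snd (f \<gamma>')) \<and> pre n w = pre n w' \<and> pre n \<gamma> = pre n \<gamma>'" for n
        using *[of n] unfolding C_def by blast
    qed (intro continuous_intros f)
    ultimately show "C z \<gamma> w" by (simp add: C_def)
  qed

  have cod_unique: "x = y" if "cod z x" "cod z y" for x y z
  proof -
    have "dist x y \<le> 2 * (1 / 2) ^ n" for n
      using that dist_triangle2[of x y "d (z n)"] unfolding cod_def by (smt (verit))
    moreover have "(\<lambda>n. 2 * (1 / 2) ^ n :: real) \<longlonglongrightarrow> 2 * 0"
      by (intro tendsto_intros LIMSEQ_realpow_zero) auto
    ultimately have "dist x y \<le> 2 * 0"
      using LIMSEQ_le_const by blast
    then show ?thesis by simp
  qed
  have cod_\<phi>: "cod (\<phi> x) x" for x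
    unfolding cod_def
  proof
    fix n
    have "x \<in> ball x ((1 / 2) ^ n)" by simp
    then obtain y where "y \<in> D" "y \<in> ball x ((1 / 2) ^ n)"
      using D(3)[OF open_ball] by blast
    moreover from this obtain m where "y = d m"
      using from_nat_into_surj[OF D(1)] unfolding d_def by metis
    ultimately have "dist x (d m) \<le> (1 / 2) ^ n" by simp
    then show "dist x (d (\<phi> x n)) \<le> (1 / 2) ^ n"
      unfolding \<phi>_def by (rule LeastI)
  qed
  \<comment> \<open>Adjacent links share a code and hence a point, so the links compose by
    transitivity of \<open>P\<close>; the empty chain is covered by reflexivity.\<close>
  have chain_P: "\<exists>y. cod w y \<and> (x, y) \<in> P" if "R\<^sup>*\<^sup>* z w" "cod z x" "x \<in> X" for x z w
    using that(1)
  proof (induction rule: rtranclp_induct)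
    case base
    then show ?case using that P(2) by blast
  next
    case (step w w')
    then obtain y \<gamma> where "cod w y" "(x, y) \<in> P" "C w \<gamma> w'" by (auto simp: R_def)
    then have "f \<gamma> = (y, snd (f \<gamma>))" "cod w' (snd (f \<gamma>))"
      using cod_unique by (auto simp: C_def prod_eq_iff)
    moreover have "f \<gamma> \<in> P" using f(2) by auto
    ultimately show ?case using \<open>(x, y) \<in> P\<close> P(3) by (metis transD)
  qed

  define F where "F x = code_of (Gp (\<phi> x))" for x
  have F_codes: "F x \<in> group_codes" for x
    unfolding F_def by (intro code_of_in_group_codes add_subgroup_Gp infinite_Gp)
  have "(\<lambda>x. \<phi> x n) \<in> measurable borel (count_space UNIV)" for n
    unfolding \<phi>_def by measurable
  then have "F \<in> measurable borel borel"
    unfolding F_def[abs_def] by (intro measurable_code_of infinite_Gp measurable_Gp) auto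
  then have "borel_map X group_codes F"
    unfolding borel_map_def
    by (intro measurable_restrict_space2 measurable_restrict_space1) (auto simp: F_codes)
  moreover have "(x, y) \<in> P \<longleftrightarrow> (F x, F y) \<in> epi_rel" if "x \<in> X" for x y
  proof -
    have "(F x, F y) \<in> epi_rel \<longleftrightarrow> (\<exists>\<psi>. (\<forall>a\<in>Gp (\<phi> y). \<forall>b\<in>Gp (\<phi> y). \<psi> (a + b) = \<psi> a + \<psi> b)
        \<and> \<psi> ` Gp (\<phi> y) = Gp (\<phi> x))"
      unfolding F_def by (intro epi_rel_code_of_iff add_subgroup_Gp infinite_Gp)
    also have "\<dots> \<longleftrightarrow> (x, y) \<in> P"
    proof
      assume "(x, y) \<in> P"
      then obtain \<gamma> where "f \<gamma> = (x, y)" using f(2) by (metis imageE)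
      then have "C (\<phi> x) \<gamma> (\<phi> y)" using cod_\<phi> by (simp add: C_def)
      then obtain \<psi> where "additive \<psi>" "\<psi> ` Gp (\<phi> y) = Gp (\<phi> x)"
        by (rule epimorphism_of_witness)
      then show "\<exists>\<psi>. (\<forall>a\<in>Gp (\<phi> y). \<forall>b\<in>Gp (\<phi> y). \<psi> (a + b) = \<psi> a + \<psi> b) \<and> \<psi> ` Gp (\<phi> y) = Gp (\<phi> x)"
        by (intro exI[of _ \<psi>]) (simp add: additive.add)
    next
      assume "\<exists>\<psi>. (\<forall>a\<in>Gp (\<phi> y). \<forall>b\<in>Gp (\<phi> y). \<psi> (a + b) = \<psi> a + \<psi> b) \<and> \<psi> ` Gp (\<phi> y) = Gp (\<phi> x)"
      then have "R\<^sup>*\<^sup>* (\<phi> x) (\<phi> y)" using epimorphism_imp_chain by blast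
      then obtain y' where "cod (\<phi> y) y'" "(x, y') \<in> P" using chain_P cod_\<phi> \<open>x \<in> X\<close> by blast
      then show "(x, y) \<in> P" using cod_unique cod_\<phi> by blast
    qed
    finally show ?thesis by simp
  qed
  ultimately show ?thesis
    unfolding borel_reduces_def using F_codes by (intro exI[of _ F]) auto
qed

text \<open>A reduction of \<open>E\<close> to \<open>epi_rel\<close> also reduces it to the
  symmetric part, because \<open>E\<close> is symmetric.\<close>

lemma borel_reduces_biepi_rel:
  fixes X :: "'a::polish_space set"
  assumes "analytic E" "equiv_rel_on X E"
  shows "borel_reduces X E group_codes biepi_rel"
proof -
  have "quasi_order_on X E" and sym: "\<And>x y. (x, y) \<in> E \<Longrightarrow> (y, x) \<in> E"
    using assms(2) by (auto simp: equiv_rel_on_def quasi_order_on_def equiv_def dest: symD)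
  then have "borel_reduces X E group_codes epi_rel"
    using assms(1) by (intro borel_reduces_epi_rel)
  then obtain f where f: "borel_map X group_codes f" "f ` X \<subseteq> group_codes"
    and iff: "\<And>x y. x \<in> X \<Longrightarrow> y \<in> X \<Longrightarrow> (x, y) \<in> E \<longleftrightarrow> (f x, f y) \<in> epi_rel"
    unfolding borel_reduces_def by blast
  have "(x, y) \<in> E \<longleftrightarrow> (f x, f y) \<in> biepi_rel" if "x \<in> X" "y \<in> X" for x y
    using iff[OF that] iff[OF that(2,1)] sym[of x y] by (auto simp: biepi_rel_def)
  then show ?thesis
    unfolding borel_reduces_def using f by blast
qed

theorem theorem1p1:
  shows "(analytic epi_rel \<and> quasi_order_on group_codes epi_rel \<and>
          (\<forall>(X :: 'a::polish_space set) P. X \<in> sets borel \<and> analytic P \<and> quasi_order_on X P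
              \<longrightarrow> borel_reduces X P group_codes epi_rel))
       \<and> (analytic biepi_rel \<and> equiv_rel_on group_codes biepi_rel \<and>
          (\<forall>(X :: 'a::polish_space set) E. X \<in> sets borel \<and> analytic E \<and> equiv_rel_on X E
              \<longrightarrow> borel_reduces X E group_codes biepi_rel))"
  using analytic_epi_rel quasi_order_on_epi_rel borel_reduces_epi_rel
    analytic_biepi_rel equiv_rel_on_biepi_rel borel_reduces_biepi_rel by blast

end
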